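(* Suppose that Assumption A and Assumption B (both stated in the context) hold. Let $0<\sigma<2$ and $0<\delta<1/L_{\nabla h}$, let $\{W^k\}$, $W^k=(x^k,y^k,u^k)$, together with $\{\theta_k\}$, be generated by the algorithm FPSA described in the context, and let $\Omega$ be the set of accumulation points of $\{W^k\}$. Then: (i) $\lim_{k\to\infty}\theta_k$ exists; denoting it by $\overline\theta$, one has $\overline\theta\ge 0$. (ii) $\vartheta(x,u;\delta)=\overline\theta$ for every $(x,y,u)\in\Omega$. (iii) Any accumulation point $\overline x$ of $\{x^k\}$ is a (limiting) lifted stationary point of the problem $\min_{x\in\mathcal S}\frac{g(x)+h(x)}{f(Kx)}$. Moreover, $\overline\theta=\frac{g(\overline x)+h(\overline x)}{f(K\overline x)}$ for any accumulation point $\overline x$ of $\{x^k\}$. (iv) $$\lim_{k\to+\infty}\frac{\langle Kx^{k+1},y^{k+1}\rangle-f^*(y^{k+1})}{f(Kx^k)}=1.$$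
   Context: Notation: $\overline{\mathbb R}=\mathbb R\cup\{+\infty\}$; $\|\cdot\|$ is the Euclidean norm; $\iota_{\mathcal S}$ is the indicator function of $\mathcal S$ ($0$ on $\mathcal S$, $+\infty$ elsewhere); $f^*(z)=\sup_w\{\langle w,z\rangle-f(w)\}$ is the convex conjugate; $\partial$ is the (limiting) subdifferential, which for convex functions is the usual convex subdifferential; $\mathrm{ri}$, $\mathrm{int}$ denote relative interior and interior. Problem: $\min_{x\in\mathcal S}\frac{g(x)+h(x)}{f(Kx)}$, where $\mathcal S\subseteq\mathbb R^n$, $g:\mathbb R^n\to\overline{\mathbb R}$, $h:\mathbb R^n\to\mathbb R$, $f:\mathbb R^p\to\overline{\mathbb R}$, and $K:\mathbb R^n\to\mathbb R^p$ is linear with transpose (adjoint) $K^\top$. Assumption A: (a) $\mathcal S$ is nonempty, convex and compact; (b) $g$ is proper, convex and lower semicontinuous; (c) $h$ (possibly nonconvex) is differentiable with Lipschitz continuous gradient, with Lipschitz constant $L_{\nabla h}$, over an open set containing $\mathcal S$; (d) $f$ is proper, convex and lower semicontinuous, $K(\mathcal S)\subseteq\mathrm{int}(\mathrm{dom}\, f)$ and $f(Kx)>0$ for all $x\in\mathcal S$; (e) $\mathcal S\cap\mathrm{dom}\, g\ne\emptyset$ and $\inf_{x\in\mathcal S}\{g(x)+h(x)\}\ge 0$. Assumption B: $\mathrm{ri}(\mathcal S)\cap\mathrm{ri}(\mathrm{dom}\, g)\neq\emptyset$, or $\mathcal S\cap\mathrm{ri}(\mathrm{dom}\, g)\ne\emptyset$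 in case $\mathcal S$ is polyhedral. Functions: $\varphi(x,u;\delta)=g(x)+h(x)+\iota_{\mathcal S}(x)+\frac1{2\delta}\|x-u\|^2$ and $\vartheta(x,u;\delta)=\frac{\varphi(x,u;\delta)}{f(Kx)}$ (with value $+\infty$ if $x\notin\mathcal S\cap\mathrm{dom}\,g$). Algorithm FPSA with constants $\delta,\sigma$ ($1/L_{\nabla h}:=+\infty$ if $L_{\nabla h}=0$): start from $x^0\in\mathcal S\cap\mathrm{dom}\,g$, $u^0\in\mathbb R^n$, $\theta_0=\vartheta(x^0,u^0;\delta)$, and for $k=0,1,2,\dots$ choose/compute $$y^{k+1}\in\partial f(Kx^k),$$ $$x^{k+1}\in\arg\min_{x\in\mathcal S}\Big[g(x)+\tfrac1{2\delta}\|x-u^k+\delta\nabla h(x^k)-\theta_k\delta K^\top y^{k+1}\|^2\Big],$$ $$u^{k+1}=(1-\sigma)u^k+\sigma x^{k+1},\qquad \theta_{k+1}=\vartheta(x^{k+1},u^{k+1};\delta).$$ A point $\overline x$ is a (limiting) lifted stationary point of the problem if $0\in(\partial g(\overline x)+\nabla h(\overline x)+\partial\iota_{\mathcal S}(\overline x))f(K\overline x)-(g(\overline x)+h(\overline x))K^\top\partial f(K\overline x)$. *)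

theory Defs
  imports "HOL-Analysis.Analysis"
begin

text \<open>Functions with values in the reals extended by plus infinity are modelled as
  \<^typ>\<open>ereal\<close>-valued functions; properness excludes the value \<open>-\<infinity>\<close>.\<close>

definition edom :: "('a \<Rightarrow> ereal) \<Rightarrow> 'a set" where
  "edom F = {x. F x < \<infinity>}"

definition proper_fun :: "('a \<Rightarrow> ereal) \<Rightarrow> bool" where
  "proper_fun F \<longleftrightarrow> (\<forall>x. F x \<noteq> -\<infinity>) \<and> edom F \<noteq> {}"

definition convex_fun :: "('a::real_vector \<Rightarrow> ereal) \<Rightarrow> bool" where
  "convex_fun F \<longleftrightarrow>
     (\<forall>x y. \<forall>t\<in>{0<..<1}. F ((1 - t) *\<^sub>R x + t *\<^sub>R y) \<le> ereal (1 - t) * F x + ereal t * F y)"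

definition lsc_fun :: "('a::topological_space \<Rightarrow> ereal) \<Rightarrow> bool" where
  "lsc_fun F \<longleftrightarrow> (\<forall>x. F x \<le> Liminf (at x) F)"

definition indicator_fun :: "'a set \<Rightarrow> 'a \<Rightarrow> ereal" where
  "indicator_fun S x = (if x \<in> S then 0 else \<infinity>)"

definition conjugate :: "('a::real_inner \<Rightarrow> ereal) \<Rightarrow> 'a \<Rightarrow> ereal" where
  "conjugate F z = (SUP w. ereal (w \<bullet> z) - F w)"

text \<open>Both subdifferentials are empty at points where the function is not finite.\<close>

definition frechet_subdiff :: "('a::real_inner \<Rightarrow> ereal) \<Rightarrow> 'a \<Rightarrow> 'a set" where
  "frechet_subdiff F x =
     {v. \<bar>F x\<bar> \<noteq> \<infinity> \<and>
         Liminf (at x) (\<lambda>z. (F z - F x - ereal (v \<bullet> (z - x))) / ereal (norm (z - x))) \<ge> 0}"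

definition limiting_subdiff :: "('a::real_inner \<Rightarrow> ereal) \<Rightarrow> 'a \<Rightarrow> 'a set" where
  "limiting_subdiff F x =
     {v. \<bar>F x\<bar> \<noteq> \<infinity> \<and>
         (\<exists>\<xi> \<nu>. \<xi> \<longlonglongrightarrow> x \<and> (\<lambda>k. F (\<xi> k)) \<longlonglongrightarrow> F x \<and> \<nu> \<longlonglongrightarrow> v \<and>
                (\<forall>k::nat. \<nu> k \<in> frechet_subdiff F (\<xi> k)))}"

definition grad :: "('a::real_inner \<Rightarrow> real) \<Rightarrow> 'a \<Rightarrow> 'a" where
  "grad h x = (THE d. GDERIV h x :> d)"

text \<open>Accumulation points of a sequence (limits of subsequences), as opposed to limit points
  of its range.\<close>

definition accumulation_points :: "(nat \<Rightarrow> 'a::topological_space) \<Rightarrow> 'a set" where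
  "accumulation_points X = {l. \<exists>r. strict_mono r \<and> (X \<circ> r) \<longlonglongrightarrow> l}"

definition merit_num ::
  "('a::real_inner) set \<Rightarrow> ('a \<Rightarrow> ereal) \<Rightarrow> ('a \<Rightarrow> real) \<Rightarrow> real \<Rightarrow> 'a \<Rightarrow> 'a \<Rightarrow> ereal" where
  "merit_num S g h \<delta> x u =
     g x + ereal (h x) + indicator_fun S x + ereal (1 / (2 * \<delta>) * (norm (x - u))\<^sup>2)"

definition merit ::
  "('a::real_inner) set \<Rightarrow> ('a \<Rightarrow> ereal) \<Rightarrow> ('a \<Rightarrow> real) \<Rightarrow> ('b \<Rightarrow> ereal) \<Rightarrow> ('a \<Rightarrow> 'b) \<Rightarrow>
    real \<Rightarrow> 'a \<Rightarrow> 'a \<Rightarrow> ereal" where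
  "merit S g h f K \<delta> x u =
     (if x \<in> S \<inter> edom g then merit_num S g h \<delta> x u / f (K x) else \<infinity>)"

text \<open>The entry \<open>y 0\<close> is not used by the algorithm and is left arbitrary. The numbers
  \<open>\<theta> k\<close> are real because every iterate lies in \<open>S \<inter> edom g\<close>.\<close>

definition fpsa ::
  "('a::euclidean_space) set \<Rightarrow> ('a \<Rightarrow> ereal) \<Rightarrow> ('a \<Rightarrow> real) \<Rightarrow> ('b::euclidean_space \<Rightarrow> ereal) \<Rightarrow>
    ('a \<Rightarrow> 'b) \<Rightarrow> real \<Rightarrow> real \<Rightarrow>
    (nat \<Rightarrow> 'a) \<Rightarrow> (nat \<Rightarrow> 'b) \<Rightarrow> (nat \<Rightarrow> 'a) \<Rightarrow> (nat \<Rightarrow> real) \<Rightarrow> bool" where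
  "fpsa S g h f K \<delta> \<sigma> x y u \<theta> \<longleftrightarrow>
     x 0 \<in> S \<inter> edom g \<and>
     ereal (\<theta> 0) = merit S g h f K \<delta> (x 0) (u 0) \<and>
     (\<forall>k. y (Suc k) \<in> limiting_subdiff f (K (x k)) \<and>
          is_arg_min
            (\<lambda>z. g z + ereal (1 / (2 * \<delta>) *
                (norm (z - u k + \<delta> *\<^sub>R grad h (x k) - (\<theta> k * \<delta>) *\<^sub>R adjoint K (y (Suc k))))\<^sup>2))
            (\<lambda>z. z \<in> S) (x (Suc k)) \<and>
          u (Suc k) = (1 - \<sigma>) *\<^sub>R u k + \<sigma> *\<^sub>R x (Suc k) \<and>
          ereal (\<theta> (Suc k)) = merit S g h f K \<delta> (x (Suc k)) (u (Suc k)))"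

text \<open>If \<open>g x\<close> or \<open>f (K x)\<close> is infinite, a subdifferential below is empty, so the conversion
  \<^const>\<open>real_of_ereal\<close> is only ever relevant for finite values.\<close>

definition lifted_stationary ::
  "('a::euclidean_space) set \<Rightarrow> ('a \<Rightarrow> ereal) \<Rightarrow> ('a \<Rightarrow> real) \<Rightarrow> ('b::euclidean_space \<Rightarrow> ereal) \<Rightarrow>
    ('a \<Rightarrow> 'b) \<Rightarrow> 'a \<Rightarrow> bool" where
  "lifted_stationary S g h f K x \<longleftrightarrow>
     0 \<in> {real_of_ereal (f (K x)) *\<^sub>R (v + grad h x + w)
            - real_of_ereal (g x + ereal (h x)) *\<^sub>R adjoint K y | v w y.
          v \<in> limiting_subdiff g x \<and> w \<in> limiting_subdiff (indicator_fun S) x \<and>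
          y \<in> limiting_subdiff f (K x)}"

end

theory Submission
  imports Defs
begin

text \<open>
  The numbers \<open>\<theta> k\<close> are ratios that are updated in the manner of Dinkelbach: the next iterate
  decreases a model of the numerator minus \<open>\<theta> k\<close> times the denominator. The model is an upper bound,
  because \<open>h\<close> lies below its quadratic model of curvature \<open>L < 1 / \<delta>\<close> and the convex
  function \<open>f\<close> lies above its linearisation. This yields the estimate of \<open>sufficient_decrease\<close>: the
  sequence \<open>\<theta>\<close> decreases, and its decrease dominates the squared distances of \<open>x (k + 1)\<close> to
  \<open>x k\<close> and to \<open>u k\<close>. Since \<open>\<theta> \<ge> 0\<close>, the sequence converges and these distances tend to zero
  (\<open>steps_vanish\<close>).

  Consequently \<open>x k\<close>, \<open>x (k + 1)\<close> and \<open>u k\<close> accumulate at the same points. The subgradients \<open>y (k + 1)\<close>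
  are bounded, as \<open>K ` S\<close> is a compact part of the interior of the domain of \<open>f\<close>, so that the
  optimality condition of the proximal step passes to the limit (\<open>accumulation\<close>). Besides the value
  of the objective at an accumulation point, this gives a subgradient of \<open>g\<close> plus the indicator
  function of \<open>S\<close>.

  To obtain a lifted stationary point, this subgradient has to be split into a subgradient
  of \<open>g\<close> and a normal vector to \<open>S\<close> (\<open>subdiff_sum_indicator\<close>). This is where the constraint
  qualification enters. If the relative interiors meet, the splitting comes from a Lagrange
  multiplier that is found by separating a convex set from the origin (\<open>equality_multiplier\<close>). If
  \<open>S\<close> is polyhedral, it comes from a Farkas lemma that is proved by induction on the number of
  half-spaces (\<open>sandwich_halfspaces\<close>).
\<close>

section \<open>Affine minorants of convex functions that are nonnegative on a convex set\<close>

text \<open>A segment of \<open>C\<close> that ends in a relative interior point \<open>x0\<close> can be prolonged beyond \<open>x0\<close>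
  within \<open>C\<close>; an affine function that vanishes at \<open>x0\<close> and is positive somewhere would become
  negative there. This is what rules out vertical separating hyperplanes below.\<close>
lemma affine_zero_on:
  fixes C :: "'a::euclidean_space set"
  assumes "convex C" "x0 \<in> rel_interior C"
    and nonneg: "\<And>z. z \<in> C \<Longrightarrow> 0 \<le> c \<bullet> z + d"
    and "c \<bullet> x0 + d \<le> 0" and "z \<in> C"
  shows "c \<bullet> z + d = 0"
proof -
  obtain e where e: "e > 1" "(1 - e) *\<^sub>R z + e *\<^sub>R x0 \<in> C"
    using assms convex_rel_interior_iff[of C x0] by blast
  have "0 \<le> (1 - e) * (c \<bullet> z + d) + e * (c \<bullet> x0 + d)"
    using nonneg[OF e(2)] by (simp add: algebra_simps)
  moreover have "e * (c \<bullet> x0 + d) \<le> 0"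
    using assms e by (simp add: mult_nonneg_nonpos)
  ultimately have "0 \<le> (1 - e) * (c \<bullet> z + d)" by linarith
  with e have "c \<bullet> z + d \<le> 0" by (simp add: zero_le_mult_iff)
  with nonneg[OF \<open>z \<in> C\<close>] show ?thesis by linarith
qed

lemma convex_on_affine:
  fixes c :: "'a::real_inner"
  assumes "convex C"
  shows "convex_on C (\<lambda>z. c \<bullet> z + d)"
proof (rule convex_onI)
  fix t :: real and z w
  have "c \<bullet> ((1 - t) *\<^sub>R z + t *\<^sub>R w) + d = (1 - t) * (c \<bullet> z + d) + t * (c \<bullet> w + d)"
    by (simp add: inner_simps algebra_simps)
  then show "c \<bullet> ((1 - t) *\<^sub>R z + t *\<^sub>R w) + d \<le> (1 - t) * (c \<bullet> z + d) + t * (c \<bullet> w + d)" by simp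
qed (fact assms)

text \<open>The strict epigraph of the perturbation function of minimising \<open>G\<close> over \<open>C\<close> subject to
  \<open>T z = b\<close>: the pairs of a constraint violation and a value that can be beaten with it.
  Multipliers arise by separating it from the origin.\<close>
lemma convex_perturbation_set:
  assumes G: "convex_on C G" and T: "linear T"
  shows "convex {(T z - b, t) | z t. z \<in> C \<and> G z < t}"
proof (rule convexI)
  fix p q :: "'b \<times> real" and r s :: real
  assume "p \<in> {(T z - b, t) | z t. z \<in> C \<and> G z < t}" "q \<in> {(T z - b, t) | z t. z \<in> C \<and> G z < t}"
    and rs: "0 \<le> r" "0 \<le> s" "r + s = 1"
  then obtain z t z' t' where
    p: "p = (T z - b, t)" "z \<in> C" "G z < t" and q: "q = (T z' - b, t')" "z' \<in> C" "G z' < t'" by blast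
  let ?z = "r *\<^sub>R z + s *\<^sub>R z'"
  have "?z \<in> C" using G p q rs by (auto simp: convex_on_def convex_def)
  moreover have "G ?z < r * t + s * t'"
  proof -
    have "G ?z \<le> r * G z + s * G z'" using G p q rs by (auto simp: convex_on_def)
    also have "\<dots> < r * t + s * t'"
    proof (cases "r = 0")
      case True with rs p q show ?thesis by simp
    next
      case False with rs p q show ?thesis
        by (intro add_less_le_mono mult_strict_left_mono mult_left_mono) auto
    qed
    finally show ?thesis .
  qed
  moreover have "r *\<^sub>R (T z - b) + s *\<^sub>R (T z' - b) = T ?z - b"
  proof -
    have "r *\<^sub>R b + s *\<^sub>R b = b" using rs by (metis scaleR_left_distrib scaleR_one)
    then show ?thesis using T by (simp add: linear_add linear_scale algebra_simps)
  qed
  ultimately show "r *\<^sub>R p + s *\<^sub>R q \<in> {(T z - b, t) | z t. z \<in> C \<and> G z < t}"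
    using p q by auto
qed

lemma nonneg_coefficient:
  fixes a b :: real assumes "\<And>t. t > t0 \<Longrightarrow> 0 \<le> a + b * t" shows "0 \<le> b"
proof (rule ccontr)
  assume b: "\<not> 0 \<le> b"
  define t where "t = max (t0 + 1) ((\<bar>a\<bar> + 1) / (- b))"
  have "t > t0" by (simp add: t_def)
  have "(\<bar>a\<bar> + 1) / (- b) \<le> t" by (simp add: t_def)
  with b have "\<bar>a\<bar> + 1 \<le> t * (- b)" by (subst (asm) pos_divide_le_eq) auto
  with assms[OF \<open>t > t0\<close>] show False by (simp add: algebra_simps)
qed

lemma nonneg_of_strict_upper_bounds:
  fixes a b x :: real
  assumes "0 < b" "\<And>t. t > x \<Longrightarrow> 0 \<le> a + b * t"
  shows "0 \<le> x + a / b"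
proof -
  have "- a / b \<le> x"
  proof (rule dense_ge)
    fix t assume "x < t"
    with assms(2)[OF this] assms(1) show "- a / b \<le> t"
      using pos_divide_le_eq[of b "- a" t] by (simp add: mult.commute)
  qed
  then show ?thesis by simp
qed

text \<open>Lagrange multipliers for affine equality constraints. The origin is separated from the set
  above by a vector \<open>(\<alpha>, \<beta>)\<close> in the span of that set, so that it is not orthogonal to all of it.
  If \<open>\<beta> = 0\<close>, then \<open>\<alpha>\<close> would give an affine function that is nonnegative on \<open>C\<close> and zero at the
  relative interior point \<open>x0\<close>, hence zero on \<open>C\<close>, against that choice.\<close>
lemma equality_multiplier:
  fixes T :: "'a::euclidean_space \<Rightarrow> 'b::euclidean_space"
  assumes G: "convex_on C G" and T: "linear T"
    and x0: "x0 \<in> rel_interior C" "T x0 = b"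
    and nonneg: "\<And>z. z \<in> C \<Longrightarrow> T z = b \<Longrightarrow> 0 \<le> G z"
  obtains a where "\<And>z. z \<in> C \<Longrightarrow> 0 \<le> G z + a \<bullet> (T z - b)"
proof -
  define E where "E = {(T z - b, t) | z t. z \<in> C \<and> G z < t}"
  have "x0 \<in> C" using x0 rel_interior_subset by blast
  then have Ene: "E \<noteq> {}" unfolding E_def using less_add_one by blast
  have "convex E" unfolding E_def by (rule convex_perturbation_set[OF G T])
  moreover have "0 \<notin> E" using nonneg by (force simp: E_def zero_prod_def)
  ultimately obtain p where p: "p \<in> span E" "p \<noteq> 0" "\<And>e. e \<in> E \<Longrightarrow> 0 \<le> p \<bullet> e"
    using separating_hyperplane_set_0_inspan Ene by metis
  obtain \<alpha> \<beta> where ab: "p = (\<alpha>, \<beta>)" by (cases p)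
  have sep: "0 \<le> \<alpha> \<bullet> (T z - b) + \<beta> * t" if "z \<in> C" "G z < t" for z t
    using p(3)[of "(T z - b, t)"] that ab by (auto simp: E_def)
  have "0 \<le> \<beta>" using nonneg_coefficient[of "G x0"] sep[OF \<open>x0 \<in> C\<close>] by blast
  have "\<beta> \<noteq> 0"
  proof
    assume "\<beta> = 0"
    have aff: "\<alpha> \<bullet> (T z - b) = adjoint T \<alpha> \<bullet> z + - (\<alpha> \<bullet> b)" for z
      using adjoint_works[OF T, of z \<alpha>] by (simp add: inner_commute inner_diff_right)
    have "\<alpha> \<bullet> (T z - b) = 0" if "z \<in> C" for z
      unfolding aff
    proof (rule affine_zero_on[OF _ x0(1) _ _ that])
      show "convex C" using G by (simp add: convex_on_def)
      show "0 \<le> adjoint T \<alpha> \<bullet> w + - (\<alpha> \<bullet> b)" if "w \<in> C" for w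
        using sep[OF that, of "G w + 1"] \<open>\<beta> = 0\<close> unfolding aff by simp
      show "adjoint T \<alpha> \<bullet> x0 + - (\<alpha> \<bullet> b) \<le> 0"
        using x0(2) unfolding aff[symmetric] by simp
    qed
    then have "\<And>e. e \<in> E \<Longrightarrow> orthogonal p e"
      using ab \<open>\<beta> = 0\<close> by (auto simp: E_def orthogonal_def)
    then have "orthogonal p p" using orthogonal_to_span[OF p(1)] by blast
    then show False using p(2) by (simp add: orthogonal_def)
  qed
  with \<open>0 \<le> \<beta>\<close> have "0 < \<beta>" by simp
  have "0 \<le> G z + (\<alpha> /\<^sub>R \<beta>) \<bullet> (T z - b)" if "z \<in> C" for z
    using nonneg_of_strict_upper_bounds[OF \<open>0 < \<beta>\<close> sep[OF that]] by (simp add: divide_inverse_commute)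
  then show thesis by (rule that)
qed

text \<open>The condition \<open>z \<in> S\<close> becomes the equality constraint \<open>z - s = 0\<close> for pairs
  \<open>(z, s) \<in> C \<times> S\<close>, and the common relative interior point of \<open>S\<close> and \<open>C\<close> is the Slater point.\<close>
lemma sandwich_rel_interior:
  fixes C S :: "'a::euclidean_space set"
  assumes G: "convex_on C G" and S: "convex S" "rel_interior S \<inter> rel_interior C \<noteq> {}"
    and nonneg: "\<And>z. z \<in> C \<inter> S \<Longrightarrow> 0 \<le> G z"
    and xb: "xb \<in> C \<inter> S" "G xb = 0"
  obtains c d where "\<And>z. z \<in> S \<Longrightarrow> c \<bullet> z + d \<le> 0" "\<And>z. z \<in> C \<Longrightarrow> 0 \<le> G z + (c \<bullet> z + d)"
proof -
  have C: "convex C" using G by (simp add: convex_on_def)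
  obtain x0 where x0: "x0 \<in> rel_interior S" "x0 \<in> rel_interior C" using S by blast
  have lin: "linear (\<lambda>p::'a\<times>'a. fst p - snd p)"
    by (intro linearI) (auto simp: algebra_simps)
  have G': "convex_on (C \<times> S) (\<lambda>p. G (fst p))"
    using G C S(1) by (auto simp: convex_on_def convex_Times)
  obtain a where a: "\<And>p. p \<in> C \<times> S \<Longrightarrow> 0 \<le> G (fst p) + a \<bullet> (fst p - snd p - 0)"
  proof (rule equality_multiplier[OF G' lin])
    show "(x0, x0) \<in> rel_interior (C \<times> S)"
      using x0 C S by (simp add: rel_interior_Times)
    show "fst (x0, x0) - snd (x0, x0) = 0" by simp
    show "0 \<le> G (fst p)" if "p \<in> C \<times> S" "fst p - snd p = 0" for p
      using that nonneg by auto
  qed blast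
  show thesis
  proof (rule that[of a "- (a \<bullet> xb)"])
    show "a \<bullet> z + - (a \<bullet> xb) \<le> 0" if "z \<in> S" for z
      using a[of "(xb, z)"] that xb by (simp add: inner_diff_right)
    show "0 \<le> G z + (a \<bullet> z + - (a \<bullet> xb))" if "z \<in> C" for z
      using a[of "(z, xb)"] that xb by (simp add: inner_diff_right)
  qed
qed

text \<open>A convex Farkas lemma: for linear inequality constraints, a relative interior point of \<open>C\<close>
  alone that satisfies them is enough. The induction adds one half-space \<open>H = {z. a \<bullet> z \<le> b}\<close> and
  separates the origin from a subset of the plane, the strict epigraph of the perturbation of this
  one constraint over \<open>C \<inter> \<Inter>F\<close>. If the separating line is not vertical, it gives a multiplier \<open>m\<close>
  for \<open>H\<close>, and the induction hypothesis applies to \<open>G + m (a \<bullet> z - b)\<close>.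

  If it is vertical, then \<open>a \<bullet> z \<ge> b\<close> on \<open>C \<inter> \<Inter>F\<close>. The induction hypothesis for the affine
  function \<open>a \<bullet> z - b\<close>, together with the relative interior point, shows that this function equals
  \<open>- (c \<bullet> z + d)\<close> on \<open>C\<close>, where \<open>c \<bullet> z + d \<le> 0\<close> on \<open>\<Inter>F\<close>. So \<open>H\<close> is an implicit equality: \<open>C\<close> is
  cut down to the hyperplane \<open>a \<bullet> z = b\<close>, which still meets its relative interior, and the equality
  is relaxed again by a multiplier \<open>m\<close> of unknown sign. A negative sign is
  harmless because \<open>m (a \<bullet> z - b)\<close> can be exchanged for \<open>- m (c \<bullet> z + d)\<close> on \<open>C\<close>.\<close>
lemma sandwich_halfspaces:
  fixes C :: "'a::euclidean_space set" and F :: "'a set set"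
  assumes "finite F" and "\<And>H. H \<in> F \<Longrightarrow> \<exists>a b. H = {z. a \<bullet> z \<le> b}"
    and "convex_on C G" and "x0 \<in> rel_interior C" "x0 \<in> \<Inter>F"
    and "\<And>z. z \<in> C \<inter> \<Inter>F \<Longrightarrow> 0 \<le> G z"
  shows "\<exists>c d. (\<forall>z\<in>\<Inter>F. c \<bullet> z + d \<le> 0) \<and> (\<forall>z\<in>C. 0 \<le> G z + (c \<bullet> z + d))"
  using assms
proof (induction F arbitrary: C G rule: finite_induct)
  case empty
  then show ?case by (intro exI[of _ 0]) auto
next
  case (insert H F)
  note G = insert.prems(2) and nonneg = insert.prems(5)
  obtain a b where H: "H = {z. a \<bullet> z \<le> b}" using insert.prems(1) by blast
  have IH: "\<exists>c d. (\<forall>z\<in>\<Inter>F. c \<bullet> z + d \<le> 0) \<and> (\<forall>z\<in>C'. 0 \<le> G' z + (c \<bullet> z + d))"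
    if "convex_on C' G'" "x0 \<in> rel_interior C'" "\<And>z. z \<in> C' \<inter> \<Inter>F \<Longrightarrow> 0 \<le> G' z"
    for C' G' using insert.IH[of C' G'] insert.prems that by simp
  have C: "convex C" using G by (simp add: convex_on_def)
  have x0: "x0 \<in> rel_interior C" "x0 \<in> C" "x0 \<in> \<Inter>F" "a \<bullet> x0 \<le> b"
    using insert.prems(3,4) rel_interior_subset[of C] H by auto
  have convF: "convex (\<Inter>F)"
    using insert.prems(1) by (intro convex_Inter) (metis convex_halfspace_le insertCI)
  \<comment> \<open>the slack \<open>r\<close> turns the inequality into an equality constraint and makes \<open>\<alpha>\<close> nonnegative\<close>
  define E where "E = {(a \<bullet> z - b + r, t) | z r t. z \<in> C \<inter> \<Inter>F \<and> 0 \<le> r \<and> G z < t}"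
  have convE: "convex E"
  proof -
    have "convex_on (C \<inter> \<Inter>F) G" using G convF by (auto simp: convex_on_def convex_Int)
    then have *: "convex_on ((C \<inter> \<Inter>F) \<times> {0..}) (\<lambda>p::'a\<times>real. G (fst p))"
      by (auto simp: convex_on_def convex_Times)
    have "linear (\<lambda>p::'a\<times>real. a \<bullet> fst p + snd p)"
      by (intro linearI) (auto simp: algebra_simps)
    from convex_perturbation_set[OF * this, of b]
    have "convex {(a \<bullet> fst p + snd p - b, t) | p t. p \<in> (C \<inter> \<Inter>F) \<times> {0..} \<and> G (fst p) < t}" .
    also have "{(a \<bullet> fst p + snd p - b, t) | p t. p \<in> (C \<inter> \<Inter>F) \<times> {0..} \<and> G (fst p) < t} = E"
      unfolding E_def by (force simp: algebra_simps)
    finally show ?thesis .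
  qed
  have "0 \<notin> E"
  proof
    assume "0 \<in> E"
    then obtain z r t where "a \<bullet> z - b + r = 0" "t = 0" "z \<in> C \<inter> \<Inter>F" "0 \<le> r" "G z < t"
      by (auto simp: E_def zero_prod_def)
    moreover from this have "z \<in> C \<inter> \<Inter>(insert H F)" by (auto simp: H)
    ultimately show False using nonneg[of z] by simp
  qed
  with convE obtain p where p: "p \<noteq> 0" "\<And>e. e \<in> E \<Longrightarrow> 0 \<le> p \<bullet> e"
    using separating_hyperplane_set_0 by metis
  obtain \<alpha> \<beta> where ab: "p = (\<alpha>, \<beta>)" by (cases p)
  have sep: "0 \<le> \<alpha> * (a \<bullet> z - b + r) + \<beta> * t" if "z \<in> C \<inter> \<Inter>F" "0 \<le> r" "G z < t" for z r t
    using p(2)[of "(a \<bullet> z - b + r, t)"] that ab by (fastforce simp: E_def)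
  have x0E: "x0 \<in> C \<inter> \<Inter>F" using x0 by blast
  have "0 \<le> \<beta>"
    using nonneg_coefficient[of "G x0"] sep[OF x0E order_refl] by blast
  have "0 \<le> \<alpha>"
  proof (rule nonneg_coefficient[of 0])
    fix r :: real assume "r > 0"
    then show "0 \<le> (\<alpha> * (a \<bullet> x0 - b) + \<beta> * (G x0 + 1)) + \<alpha> * r"
      using sep[OF x0E, of r "G x0 + 1"] by (simp add: algebra_simps)
  qed
  show ?case
  proof (cases "\<beta> = 0")
    case False
    with \<open>0 \<le> \<beta>\<close> have "0 < \<beta>" by simp
    define m where "m = \<alpha> / \<beta>"
    have "0 \<le> m" using \<open>0 \<le> \<alpha>\<close> \<open>0 < \<beta>\<close> by (simp add: m_def)
    define G' where "G' z = G z + m * (a \<bullet> z - b)" for z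
    have "convex_on C (\<lambda>z. m * (a \<bullet> z - b))"
      using convex_on_affine[OF C, of "m *\<^sub>R a" "- (m * b)"] by (simp add: algebra_simps)
    then have "convex_on C G'" unfolding G'_def using G by (rule convex_on_add[rotated])
    moreover have "0 \<le> G' z" if "z \<in> C \<inter> \<Inter>F" for z
      using nonneg_of_strict_upper_bounds[OF \<open>0 < \<beta>\<close> sep[OF that order_refl]]
      by (simp add: G'_def m_def)
    ultimately obtain c d where
      cd: "\<forall>z\<in>\<Inter>F. c \<bullet> z + d \<le> 0" "\<forall>z\<in>C. 0 \<le> G' z + (c \<bullet> z + d)"
      using IH[of C G'] x0 by blast
    have "(m *\<^sub>R a + c) \<bullet> z + (d - m * b) \<le> 0" if "z \<in> \<Inter>(insert H F)" for z
    proof -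
      have "m * (a \<bullet> z - b) \<le> 0" using \<open>0 \<le> m\<close> that by (auto simp: H mult_le_0_iff)
      moreover have "c \<bullet> z + d \<le> 0" using cd that by blast
      ultimately show ?thesis by (simp add: algebra_simps)
    qed
    moreover have "0 \<le> G z + ((m *\<^sub>R a + c) \<bullet> z + (d - m * b))" if "z \<in> C" for z
      using cd(2) that by (simp add: G'_def algebra_simps)
    ultimately show ?thesis by blast
  next
    case True
    with p ab \<open>0 \<le> \<alpha>\<close> have "0 < \<alpha>" by (auto simp: zero_prod_def)
    have aff_nonneg: "0 \<le> a \<bullet> z - b" if "z \<in> C \<inter> \<Inter>F" for z
      using sep[OF that order_refl, of "G z + 1"] True \<open>0 < \<alpha>\<close> by (simp add: zero_le_mult_iff)
    have "convex_on C (\<lambda>z. a \<bullet> z - b)"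
      using convex_on_affine[OF C, of a "- b"] by simp
    then obtain c d where
      cd: "\<forall>z\<in>\<Inter>F. c \<bullet> z + d \<le> 0" "\<forall>z\<in>C. 0 \<le> a \<bullet> z - b + (c \<bullet> z + d)"
      using IH[of C "\<lambda>z. a \<bullet> z - b"] x0 aff_nonneg by blast
    have dep: "a \<bullet> z - b = - (c \<bullet> z + d)" if "z \<in> C" for z
    proof -
      have "(a + c) \<bullet> z + (d - b) = 0"
      proof (rule affine_zero_on[OF C x0(1) _ _ that])
        show "0 \<le> (a + c) \<bullet> w + (d - b)" if "w \<in> C" for w
          using cd(2) that by (auto simp: algebra_simps)
        have "c \<bullet> x0 + d \<le> 0" using cd x0 by blast
        with x0(4) show "(a + c) \<bullet> x0 + (d - b) \<le> 0" by (simp add: algebra_simps)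
      qed
      then show ?thesis by (simp add: algebra_simps)
    qed
    define A where "A = {z. a \<bullet> z = b}"
    have "a \<bullet> x0 = b" using aff_nonneg[OF x0E] x0(4) by simp
    have aff: "affine A" unfolding A_def by (rule affine_hyperplane)
    have "x0 \<in> A" using \<open>a \<bullet> x0 = b\<close> by (simp add: A_def)
    then have "x0 \<in> rel_interior (C \<inter> A)"
      using convex_rel_interior_inter_two[OF C affine_imp_convex[OF aff]] x0(1)
        rel_interior_affine[OF aff] by blast
    moreover have "convex_on (C \<inter> A) G"
      using G affine_imp_convex[OF aff] by (auto simp: convex_on_def convex_Int)
    moreover have "0 \<le> G z" if "z \<in> C \<inter> A \<inter> \<Inter>F" for z
      using nonneg[of z] that by (auto simp: A_def H)
    ultimately obtain c' d' where
      cd': "\<forall>z\<in>\<Inter>F. c' \<bullet> z + d' \<le> 0" "\<forall>z\<in>C \<inter> A. 0 \<le> G z + (c' \<bullet> z + d')"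
      using IH[of "C \<inter> A" G] by blast
    have "convex_on C (\<lambda>z. c' \<bullet> z + d')"
      by (rule convex_on_affine[OF C])
    with G have "convex_on C (\<lambda>z. G z + (c' \<bullet> z + d'))" by (rule convex_on_add)
    moreover have "linear (\<lambda>z. a \<bullet> z)" by (intro linearI) (auto simp: algebra_simps)
    ultimately obtain m :: real where m: "\<And>z. z \<in> C \<Longrightarrow> 0 \<le> G z + (c' \<bullet> z + d') + m \<bullet> (a \<bullet> z - b)"
      using equality_multiplier[of C "\<lambda>z. G z + (c' \<bullet> z + d')" "\<lambda>z. a \<bullet> z" x0 b]
        x0(1) \<open>a \<bullet> x0 = b\<close> cd'(2) by (auto simp: A_def)
    show ?thesis
    proof (cases "0 \<le> m")
      case True
      have "(c' + m *\<^sub>R a) \<bullet> z + (d' - m * b) \<le> 0" if "z \<in> \<Inter>(insert H F)" for z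
      proof -
        have "m * (a \<bullet> z - b) \<le> 0" using \<open>0 \<le> m\<close> that by (auto simp: H mult_le_0_iff)
        moreover have "c' \<bullet> z + d' \<le> 0" using cd' that by blast
        ultimately show ?thesis by (simp add: algebra_simps)
      qed
      moreover have "0 \<le> G z + ((c' + m *\<^sub>R a) \<bullet> z + (d' - m * b))" if "z \<in> C" for z
        using m[OF that] by (simp add: algebra_simps)
      ultimately show ?thesis by blast
    next
      case False
      have "(c' - m *\<^sub>R c) \<bullet> z + (d' - m * d) \<le> 0" if "z \<in> \<Inter>(insert H F)" for z
      proof -
        have "c \<bullet> z + d \<le> 0" "c' \<bullet> z + d' \<le> 0" using cd cd' that by blast+
        moreover from this have "0 \<le> m * (c \<bullet> z + d)" using False by (simp add: zero_le_mult_iff)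
        ultimately show ?thesis by (simp add: algebra_simps)
      qed
      moreover have "0 \<le> G z + ((c' - m *\<^sub>R c) \<bullet> z + (d' - m * d))" if "z \<in> C" for z
        using m[OF that] dep[OF that] by (simp add: algebra_simps)
      ultimately show ?thesis by blast
    qed
  qed
qed

section \<open>Subdifferentials of convex functions\<close>

text \<open>The subdifferential of convex analysis, made of the slopes of global affine minorants; as
  for the limiting subdifferential, it is empty where the function is not finite.\<close>
definition convex_subdiff :: "('a::real_inner \<Rightarrow> ereal) \<Rightarrow> 'a \<Rightarrow> 'a set" where
  "convex_subdiff F x = {v. \<bar>F x\<bar> \<noteq> \<infinity> \<and> (\<forall>z. F x + ereal (v \<bullet> (z - x)) \<le> F z)}"

lemma proper_fun_finite:
  assumes "proper_fun F" "z \<in> edom F"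
  shows "F z = ereal (real_of_ereal (F z))"
  using assms by (cases "F z") (auto simp: proper_fun_def edom_def)

lemma proper_fun_edom_iff: "proper_fun F \<Longrightarrow> z \<in> edom F \<longleftrightarrow> \<bar>F z\<bar> \<noteq> \<infinity>"
  by (cases "F z") (auto simp: proper_fun_def edom_def)

lemma convex_fun_real:
  assumes "proper_fun F" "convex_fun F"
  shows "convex_on (edom F) (\<lambda>z. real_of_ereal (F z))"
proof -
  have *: "(1 - t) *\<^sub>R a + t *\<^sub>R b \<in> edom F \<and>
     real_of_ereal (F ((1 - t) *\<^sub>R a + t *\<^sub>R b)) \<le> (1 - t) * real_of_ereal (F a) + t * real_of_ereal (F b)"
    if "0 < t" "t < 1" "a \<in> edom F" "b \<in> edom F" for t a b
  proof -
    have le: "F ((1 - t) *\<^sub>R a + t *\<^sub>R b) \<le> ereal (1 - t) * F a + ereal t * F b"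
      using assms(2) that by (auto simp: convex_fun_def)
    also have "\<dots> = ereal ((1 - t) * real_of_ereal (F a) + t * real_of_ereal (F b))"
      using proper_fun_finite[OF assms(1) that(3)] proper_fun_finite[OF assms(1) that(4)]
      by (metis plus_ereal.simps(1) times_ereal.simps(1))
    finally have le': "F ((1 - t) *\<^sub>R a + t *\<^sub>R b)
      \<le> ereal ((1 - t) * real_of_ereal (F a) + t * real_of_ereal (F b))" .
    then have dom: "(1 - t) *\<^sub>R a + t *\<^sub>R b \<in> edom F"
      by (auto simp: edom_def intro: le_less_trans)
    show ?thesis using dom le' proper_fun_finite[OF assms(1) dom] by (metis ereal_less_eq(3))
  qed
  have "convex (edom F)"
    unfolding convex_alt
  proof (intro ballI allI impI)
    fix a b and t :: real assume "a \<in> edom F" "b \<in> edom F" "0 \<le> t \<and> t \<le> 1"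
    then show "(1 - t) *\<^sub>R a + t *\<^sub>R b \<in> edom F"
      using *[of t a b] by (cases "t = 0 \<or> t = 1") auto
  qed
  with * show ?thesis by (intro convex_onI) auto
qed

lemma convex_fun_continuous_interior:
  fixes F :: "'a::euclidean_space \<Rightarrow> ereal"
  assumes "proper_fun F" "convex_fun F"
  shows "continuous_on (interior (edom F)) (\<lambda>z. real_of_ereal (F z))"
proof -
  have conv: "convex_on (edom F) (\<lambda>z. real_of_ereal (F z))" using assms by (rule convex_fun_real)
  then have "convex (interior (edom F))" by (simp add: convex_on_def convex_interior)
  then have "convex_on (interior (edom F)) (\<lambda>z. real_of_ereal (F z))"
    using conv interior_subset convex_on_subset by blast
  then show ?thesis by (intro convex_on_continuous) auto
qed

text \<open>Along the segment from \<open>x\<close> to \<open>z\<close>, convexity bounds the difference quotient in the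
  definition of a Frechet subgradient by its value \<open>q\<close> at \<open>z\<close>. A nonnegative lower limit at \<open>x\<close>
  therefore forces \<open>0 \<le> q\<close>, which is the global inequality.\<close>
lemma frechet_subdiff_convex:
  assumes F: "proper_fun F" "convex_fun F"
  shows "frechet_subdiff F x = convex_subdiff F x"
proof (intro set_eqI iffI)
  fix v assume "v \<in> frechet_subdiff F x"
  then have fin: "\<bar>F x\<bar> \<noteq> \<infinity>"
    and lim: "Liminf (at x) (\<lambda>z. (F z - F x - ereal (v \<bullet> (z - x))) / ereal (norm (z - x))) \<ge> 0"
    by (auto simp: frechet_subdiff_def)
  have "F x + ereal (v \<bullet> (z - x)) \<le> F z" for z
  proof (cases "z = x \<or> F z = \<infinity>")
    case True then show ?thesis by (auto simp: zero_ereal_def[symmetric])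
  next
    case False
    then have "z \<noteq> x" and "z \<in> edom F" "x \<in> edom F"
      using F(1) fin by (auto simp: proper_fun_edom_iff proper_fun_def)
    define \<phi> where "\<phi> w = real_of_ereal (F w)" for w
    note F\<phi> = proper_fun_finite[OF F(1), folded \<phi>_def]
    have conv: "convex_on (edom F) \<phi>" using convex_fun_real[OF F] by (simp add: \<phi>_def[abs_def])
    define q where "q = (\<phi> z - \<phi> x - v \<bullet> (z - x)) / norm (z - x)"
    have "0 \<le> q"
    proof (rule ccontr)
      assume "\<not> 0 \<le> q"
      then have "ereal (q / 2) < 0" by simp
      then have ev: "\<forall>\<^sub>F w in at x. ereal (q / 2) < (F w - F x - ereal (v \<bullet> (w - x))) / ereal (norm (w - x))"
        using lim unfolding le_Liminf_iff by blast
      define w where "w t = (1 - t) *\<^sub>R x + t *\<^sub>R z" for t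
      have wx: "w t - x = t *\<^sub>R (z - x)" for t by (simp add: w_def algebra_simps)
      have "(w \<longlongrightarrow> w 0) (at_right 0)" unfolding w_def by (intro tendsto_intros)
      moreover have "\<forall>\<^sub>F t in at_right 0. w t \<noteq> x"
        unfolding eventually_at_filter using \<open>z \<noteq> x\<close> wx
        by (intro always_eventually) (metis diff_eq_diff_eq eq_iff_diff_eq_0 scaleR_eq_0_iff greaterThan_iff less_irrefl)
      ultimately have "filterlim w (at x) (at_right 0)"
        by (simp add: filterlim_at w_def)
      then have "\<forall>\<^sub>F t in at_right 0. ereal (q / 2) < (F (w t) - F x - ereal (v \<bullet> (w t - x))) / ereal (norm (w t - x))"
        using ev by (rule eventually_compose_filterlim[rotated])
      moreover have "\<forall>\<^sub>F t in at_right (0::real). 0 < t \<and> t < 1"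
        using eventually_at_right_real[of 0 1] by simp
      ultimately have "\<forall>\<^sub>F t in at_right 0. (0 < t \<and> t < 1) \<and>
          ereal (q / 2) < (F (w t) - F x - ereal (v \<bullet> (w t - x))) / ereal (norm (w t - x))"
        by (rule eventually_conj[rotated])
      then obtain t where t: "0 < t" "t < 1"
        and lt: "ereal (q / 2) < (F (w t) - F x - ereal (v \<bullet> (w t - x))) / ereal (norm (w t - x))"
        using eventually_happens[of _ "at_right (0::real)"] trivial_limit_at_right_real by blast
      have "w t \<in> edom F" using conv t \<open>z \<in> edom F\<close> \<open>x \<in> edom F\<close>
        unfolding w_def convex_on_def convex_alt by auto
      have pos: "0 < norm (z - x)" using \<open>z \<noteq> x\<close> by simp
      have "\<phi> (w t) \<le> (1 - t) * \<phi> x + t * \<phi> z"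
        unfolding w_def using convex_onD[OF conv] t \<open>z \<in> edom F\<close> \<open>x \<in> edom F\<close> by simp
      then have "(\<phi> (w t) - \<phi> x - v \<bullet> (w t - x)) \<le> t * (\<phi> z - \<phi> x - v \<bullet> (z - x))"
        unfolding wx by (simp add: algebra_simps)
      also have "\<dots> = q * norm (w t - x)" unfolding wx q_def using t pos by simp
      finally have "(\<phi> (w t) - \<phi> x - v \<bullet> (w t - x)) / norm (w t - x) \<le> q"
        using pos t unfolding wx by (subst pos_divide_le_eq) auto
      moreover have "q / 2 < (\<phi> (w t) - \<phi> x - v \<bullet> (w t - x)) / norm (w t - x)"
        using lt F\<phi>[OF \<open>w t \<in> edom F\<close>] F\<phi>[OF \<open>x \<in> edom F\<close>] pos t unfolding wx by simp
      ultimately show False using \<open>\<not> 0 \<le> q\<close> by linarith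
    qed
    then have "\<phi> x + v \<bullet> (z - x) \<le> \<phi> z"
      using \<open>z \<noteq> x\<close> by (simp add: q_def zero_le_divide_iff)
    then show ?thesis using F\<phi>[OF \<open>z \<in> edom F\<close>] F\<phi>[OF \<open>x \<in> edom F\<close>] by simp
  qed
  with fin show "v \<in> convex_subdiff F x" by (simp add: convex_subdiff_def)
next
  fix v assume "v \<in> convex_subdiff F x"
  then have fin: "\<bar>F x\<bar> \<noteq> \<infinity>" and le: "\<And>z. F x + ereal (v \<bullet> (z - x)) \<le> F z"
    by (auto simp: convex_subdiff_def)
  have "0 \<le> (F z - F x - ereal (v \<bullet> (z - x))) / ereal (norm (z - x))" for z
  proof -
    have "0 \<le> F z - F x - ereal (v \<bullet> (z - x))"
      using le[of z] fin by (cases "F z"; cases "F x") auto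
    then show ?thesis by (simp add: zero_le_divide_ereal)
  qed
  with fin show "v \<in> frechet_subdiff F x"
    by (auto simp: frechet_subdiff_def intro!: Liminf_bounded always_eventually)
qed

text \<open>The global subgradient inequality survives the limits that define limiting subgradients,
  so for convex functions nothing is gained by them.\<close>
lemma limiting_subdiff_convex:
  assumes F: "proper_fun F" "convex_fun F"
  shows "limiting_subdiff F x = convex_subdiff F x"
proof (intro set_eqI iffI)
  fix v assume "v \<in> limiting_subdiff F x"
  then obtain \<xi> \<nu> where fin: "\<bar>F x\<bar> \<noteq> \<infinity>" and lims: "\<xi> \<longlonglongrightarrow> x" "(\<lambda>k. F (\<xi> k)) \<longlonglongrightarrow> F x" "\<nu> \<longlonglongrightarrow> v"
    and \<nu>: "\<And>k::nat. \<nu> k \<in> convex_subdiff F (\<xi> k)"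
    using frechet_subdiff_convex[OF F] by (auto simp: limiting_subdiff_def)
  have "F x + ereal (v \<bullet> (z - x)) \<le> F z" for z
  proof (rule LIMSEQ_le_const2)
    show "(\<lambda>k. F (\<xi> k) + ereal (\<nu> k \<bullet> (z - \<xi> k))) \<longlonglongrightarrow> F x + ereal (v \<bullet> (z - x))"
      using fin lims by (intro tendsto_add_ereal tendsto_intros) auto
    show "\<exists>N. \<forall>n\<ge>N. F (\<xi> n) + ereal (\<nu> n \<bullet> (z - \<xi> n)) \<le> F z"
      using \<nu> by (auto simp: convex_subdiff_def)
  qed
  with fin show "v \<in> convex_subdiff F x" by (simp add: convex_subdiff_def)
next
  fix v assume "v \<in> convex_subdiff F x"
  then have "v \<in> frechet_subdiff F x" "\<bar>F x\<bar> \<noteq> \<infinity>"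
    by (simp_all add: frechet_subdiff_convex[OF F] convex_subdiff_def)
  then show "v \<in> limiting_subdiff F x"
    unfolding limiting_subdiff_def
    by (intro CollectI conjI exI[of _ "\<lambda>_. x"] exI[of _ "\<lambda>_. v"]) auto
qed

lemma proper_indicator_fun: "S \<noteq> {} \<Longrightarrow> proper_fun (indicator_fun S)"
  by (auto simp: proper_fun_def indicator_fun_def edom_def)

lemma convex_indicator_fun:
  assumes "convex S" shows "convex_fun (indicator_fun S)"
  using assms unfolding convex_fun_def indicator_fun_def convex_alt
  by (auto simp: zero_ereal_def[symmetric])

text \<open>The sum rule for \<open>g\<close> and the indicator function of \<open>S\<close>. If \<open>v\<close> is a subgradient of the sum
  at \<open>xb\<close>, then \<open>G z = g z - g xb - v \<bullet> (z - xb)\<close> is nonnegative on \<open>S\<close>, and the sandwich lemmas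
  give an affine function that is nonnegative on \<open>S\<close> and at most \<open>G\<close> on the domain of \<open>g\<close>. It
  vanishes at \<open>xb\<close>, so its slope \<open>- c\<close> splits \<open>v\<close> into the subgradient \<open>v - c\<close> of \<open>g\<close> and the normal
  vector \<open>c\<close> to \<open>S\<close>.\<close>
lemma subdiff_sum_indicator:
  fixes g :: "'a::euclidean_space \<Rightarrow> ereal"
  assumes g: "proper_fun g" "convex_fun g" and S: "convex S"
    and qual: "rel_interior S \<inter> rel_interior (edom g) \<noteq> {} \<or>
            (polyhedron S \<and> S \<inter> rel_interior (edom g) \<noteq> {})"
    and xb: "xb \<in> S" "xb \<in> edom g"
    and v: "\<And>z. z \<in> S \<Longrightarrow> g xb + ereal (v \<bullet> (z - xb)) \<le> g z"
  obtains v1 w where "v1 \<in> limiting_subdiff g xb" "w \<in> limiting_subdiff (indicator_fun S) xb" "v = v1 + w"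
proof -
  define \<phi> where "\<phi> w = real_of_ereal (g w)" for w
  note g\<phi> = proper_fun_finite[OF g(1), folded \<phi>_def]
  define C where "C = edom g"
  have conv: "convex_on C \<phi>" using convex_fun_real[OF g] by (simp add: \<phi>_def[abs_def] C_def)
  then have C: "convex C" by (simp add: convex_on_def)
  define G where "G z = \<phi> z + ((- v) \<bullet> z + (v \<bullet> xb - \<phi> xb))" for z
  have "convex_on C (\<lambda>z. (- v) \<bullet> z + (v \<bullet> xb - \<phi> xb))"
    by (rule convex_on_affine[OF C])
  then have G: "convex_on C G" unfolding G_def using conv by (rule convex_on_add[rotated])
  have "G xb = 0" by (simp add: G_def)
  have nonneg: "0 \<le> G z" if "z \<in> C \<inter> S" for z
  proof -
    have "z \<in> S" "z \<in> edom g" using that by (auto simp: C_def)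
    then have "ereal (\<phi> xb) + ereal (v \<bullet> (z - xb)) \<le> ereal (\<phi> z)"
      using v[of z] g\<phi>[of z] g\<phi>[of xb] xb by metis
    then show ?thesis by (simp add: G_def inner_diff_right)
  qed
  have "\<exists>c d. (\<forall>z\<in>S. c \<bullet> z + d \<le> 0) \<and> (\<forall>z\<in>C. 0 \<le> G z + (c \<bullet> z + d))"
    using qual
  proof
    assume "rel_interior S \<inter> rel_interior (edom g) \<noteq> {}"
    then have ri: "rel_interior S \<inter> rel_interior C \<noteq> {}" unfolding C_def .
    have "xb \<in> C \<inter> S" using xb by (simp add: C_def)
    from sandwich_rel_interior[OF G S ri nonneg this \<open>G xb = 0\<close>] show ?thesis by metis
  next
    assume poly: "polyhedron S \<and> S \<inter> rel_interior (edom g) \<noteq> {}"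
    then obtain F where F: "finite F" "S = \<Inter>F" and "\<forall>H\<in>F. \<exists>a b. a \<noteq> 0 \<and> H = {z. a \<bullet> z \<le> b}"
      unfolding polyhedron_def by blast
    then have hs: "\<exists>a b. H = {z. a \<bullet> z \<le> b}" if "H \<in> F" for H using that by blast
    obtain x0 where "x0 \<in> S" "x0 \<in> rel_interior C" using poly unfolding C_def by blast
    then show ?thesis
      using sandwich_halfspaces[OF F(1) hs G, of x0] nonneg by (simp only: F(2))
  qed
  then obtain c d where cS: "\<And>z. z \<in> S \<Longrightarrow> c \<bullet> z + d \<le> 0" and cC: "\<And>z. z \<in> C \<Longrightarrow> 0 \<le> G z + (c \<bullet> z + d)"
    by blast
  have d: "d = - (c \<bullet> xb)" using cS[of xb] cC[of xb] xb \<open>G xb = 0\<close> by (simp add: C_def)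
  have "v - c \<in> convex_subdiff g xb"
    unfolding convex_subdiff_def
  proof (intro CollectI conjI allI)
    show "\<bar>g xb\<bar> \<noteq> \<infinity>" using xb g by (simp add: proper_fun_edom_iff)
    show "g xb + ereal ((v - c) \<bullet> (z - xb)) \<le> g z" for z
    proof (cases "z \<in> C")
      case True
      then have "\<phi> xb + (v - c) \<bullet> (z - xb) \<le> \<phi> z"
        using cC[of z] by (simp add: G_def d algebra_simps)
      with True xb show ?thesis using g\<phi>[of z] g\<phi>[of xb] by (simp add: C_def)
    qed (auto simp: C_def edom_def)
  qed
  moreover have "c \<in> convex_subdiff (indicator_fun S) xb"
    using xb cS by (auto simp: convex_subdiff_def indicator_fun_def d inner_diff_right)
  moreover have "S \<noteq> {}" using xb by auto
  ultimately show thesis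
    using that[of "v - c" c] limiting_subdiff_convex[OF g]
      limiting_subdiff_convex[OF proper_indicator_fun convex_indicator_fun[OF S]] by simp
qed

lemma lsc_fun_limit_le:
  assumes "lsc_fun F" "X \<longlonglongrightarrow> a" "\<And>k. F (X k) \<le> ereal (r k)" "r \<longlonglongrightarrow> l"
  shows "F a \<le> ereal l"
proof (rule dense_le)
  fix c assume c: "c < F a"
  then have "\<forall>\<^sub>F z in at a. c < F z"
    using assms(1) unfolding lsc_fun_def le_Liminf_iff by blast
  then have "\<forall>\<^sub>F z in nhds a. c < F z"
    using c by (auto simp: eventually_at_filter elim!: eventually_mono)
  then have "\<forall>\<^sub>F k in sequentially. c < F (X k)"
    using assms(2) by (rule eventually_compose_filterlim)
  then have "\<forall>\<^sub>F k in sequentially. c \<le> ereal (r k)"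
    using assms(3) by (auto elim!: eventually_mono) (meson order.strict_implies_order order_less_le_trans)
  then show "c \<le> ereal l"
    using assms(4) by (intro tendsto_lowerbound[of "\<lambda>k. ereal (r k)"]) auto
qed

text \<open>The compact set \<open>C\<close> has a compact neighbourhood \<open>D\<close> of some radius \<open>e\<close> inside the domain, on
  which the absolute value of \<open>f\<close> is bounded by some \<open>M\<close>. A step of length \<open>e\<close> in the direction of a
  subgradient \<open>y\<close> increases \<open>f\<close> by at least \<open>e\<close> times the norm of \<open>y\<close>, but by no more than \<open>2 M\<close>.\<close>
lemma subgradients_bounded:
  fixes f :: "'a::euclidean_space \<Rightarrow> ereal"
  assumes f: "proper_fun f" "convex_fun f" and C: "compact C" "C \<subseteq> interior (edom f)"
  obtains B where "\<And>z y. z \<in> C \<Longrightarrow> y \<in> convex_subdiff f z \<Longrightarrow> norm y \<le> B"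
proof (cases "C = {}")
  case True then show thesis using that by simp
next
  case False
  define \<phi> where "\<phi> w = real_of_ereal (f w)" for w
  note f\<phi> = proper_fun_finite[OF f(1), folded \<phi>_def]
  have cont: "continuous_on (interior (edom f)) \<phi>"
    using convex_fun_continuous_interior[OF f] by (simp add: \<phi>_def[abs_def])
  obtain e where e: "0 < e" "(\<Union>z\<in>C. cball z e) \<subseteq> interior (edom f)"
    using compact_subset_open_imp_cball_epsilon_subset[OF C(1) _ C(2)] by auto
  define D where "D = (\<Union>z\<in>C. cball z e)"
  have "D = {a + b | a b. a \<in> C \<and> b \<in> cball 0 e}"
  proof (intro set_eqI iffI)
    fix w assume "w \<in> D"
    then obtain a where "a \<in> C" "w \<in> cball a e" by (auto simp: D_def)
    then show "w \<in> {a + b | a b. a \<in> C \<and> b \<in> cball 0 e}"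
      by (intro CollectI exI[of _ a] exI[of _ "w - a"]) (simp add: dist_norm norm_minus_commute)
  next
    fix w assume "w \<in> {a + b | a b. a \<in> C \<and> b \<in> cball 0 e}"
    then obtain a b where "w = a + b" "a \<in> C" "b \<in> cball 0 e" by blast
    then show "w \<in> D" unfolding D_def by (intro UN_I[of a]) (auto simp: dist_norm)
  qed
  then have "compact D" using compact_sums[OF C(1) compact_cball[of 0 e]] by simp
  then have "bounded (\<phi> ` D)"
    using cont e continuous_on_subset compact_continuous_image compact_imp_bounded unfolding D_def by metis
  then obtain M where M: "\<And>z. z \<in> D \<Longrightarrow> \<bar>\<phi> z\<bar> \<le> M" unfolding bounded_iff by auto
  show thesis
  proof (rule that)
    fix z y assume z: "z \<in> C" and y: "y \<in> convex_subdiff f z"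
    \<comment> \<open>for \<open>y = 0\<close>, \<open>w\<close> is \<open>z\<close> itself, which does no harm\<close>
    define w where "w = z + e *\<^sub>R sgn y"
    have "w \<in> D" using z e by (force simp: D_def w_def dist_norm norm_sgn)
    moreover have "z \<in> D" using z e by (force simp: D_def)
    moreover have "D \<subseteq> edom f" using e interior_subset unfolding D_def by blast
    ultimately have "f z = ereal (\<phi> z)" "f w = ereal (\<phi> w)" by (auto intro: f\<phi>)
    then have "\<phi> z + y \<bullet> (w - z) \<le> \<phi> w"
      using y unfolding convex_subdiff_def by (metis (mono_tags, lifting) ereal_less_eq(3) mem_Collect_eq plus_ereal.simps(1))
    moreover have "y \<bullet> (w - z) = e * norm y"
      by (cases "y = 0") (auto simp: w_def sgn_div_norm dot_square_norm power2_eq_square)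
    moreover have "\<bar>\<phi> w\<bar> \<le> M" "\<bar>\<phi> z\<bar> \<le> M" using M \<open>w \<in> D\<close> \<open>z \<in> D\<close> by auto
    ultimately have "e * norm y \<le> 2 * M" by linarith
    then show "norm y \<le> 2 * M / e" using e by (simp add: pos_le_divide_eq mult.commute)
  qed
qed

text \<open>The equality case of the Fenchel--Young inequality.\<close>
lemma conjugate_at_subgradient:
  assumes "y \<in> convex_subdiff f z"
  shows "conjugate f y = ereal (z \<bullet> y) - f z"
  unfolding conjugate_def
proof (rule antisym)
  have fin: "\<bar>f z\<bar> \<noteq> \<infinity>" and le: "\<And>w. f z + ereal (y \<bullet> (w - z)) \<le> f w"
    using assms by (auto simp: convex_subdiff_def)
  show "(SUP w. ereal (w \<bullet> y) - f w) \<le> ereal (z \<bullet> y) - f z"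
  proof (rule SUP_least)
    fix w show "ereal (w \<bullet> y) - f w \<le> ereal (z \<bullet> y) - f z"
      using le[of w] fin by (cases "f w"; cases "f z") (auto simp: inner_diff_right inner_commute)
  qed
qed (auto intro: SUP_upper)

section \<open>The quadratic upper bound and the proximal step\<close>

lemma GDERIV_grad:
  fixes h :: "'a::euclidean_space \<Rightarrow> real"
  assumes "h differentiable (at x)"
  shows "GDERIV h x :> grad h x"
proof -
  obtain h' where h': "(h has_derivative h') (at x)" using assms by (auto simp: differentiable_def)
  then have "linear h'" by (rule has_derivative_linear)
  then have "h' = (\<lambda>z. z \<bullet> adjoint h' 1)" using adjoint_works[of h' _ 1] by auto
  with h' have "GDERIV h x :> adjoint h' 1" by (simp add: gderiv_def)
  moreover have "d = e" if "GDERIV h x :> d" "GDERIV h x :> e" for d e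
  proof -
    have "(\<lambda>z. z \<bullet> d) = (\<lambda>z. z \<bullet> e)"
      using that has_derivative_unique unfolding gderiv_def by blast
    then have "\<forall>z. z \<bullet> d = z \<bullet> e" by (rule fun_cong[THEN allI])
    then show ?thesis by (simp only: vector_eq_ldot)
  qed
  ultimately show ?thesis unfolding grad_def by (metis theI)
qed

text \<open>The function \<open>\<phi>\<close> in the proof is the gap between \<open>h\<close> and its quadratic upper model along the
  segment from \<open>a\<close> to \<open>b\<close>, up to a constant; the Lipschitz bound on the gradient makes it nonincreasing.\<close>
lemma descent_lemma:
  fixes h :: "'a::euclidean_space \<Rightarrow> real"
  assumes diff: "\<And>z. z \<in> S \<Longrightarrow> h differentiable (at z)" and "convex S"
    and lip: "lipschitz_on L S (grad h)" and ab: "a \<in> S" "b \<in> S"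
  shows "h b \<le> h a + grad h a \<bullet> (b - a) + L / 2 * (norm (b - a))\<^sup>2"
proof -
  define d where "d = b - a"
  define p where "p t = a + t *\<^sub>R d" for t
  define \<phi> where "\<phi> t = h (p t) - t * (grad h a \<bullet> d) - L / 2 * t\<^sup>2 * (norm d)\<^sup>2" for t
  have pS: "p t \<in> S" if "0 \<le> t" "t \<le> 1" for t
  proof -
    have "p t = (1 - t) *\<^sub>R a + t *\<^sub>R b" by (simp add: p_def d_def algebra_simps)
    then show ?thesis using convexD_alt[OF \<open>convex S\<close> ab that] by simp
  qed
  have "\<phi> 1 \<le> \<phi> 0"
  proof (rule DERIV_nonpos_imp_nonincreasing[of 0 1 \<phi>])
    fix t :: real assume t: "0 \<le> t" "t \<le> 1"
    have "(h has_derivative (\<lambda>z. z \<bullet> grad h (p t))) (at (p t))"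
      using GDERIV_grad[OF diff[OF pS[OF t]]] by (simp add: gderiv_def)
    moreover have "(p has_derivative (\<lambda>s. s *\<^sub>R d)) (at t)"
      unfolding p_def by (auto intro!: derivative_eq_intros)
    ultimately have "((\<lambda>t. h (p t)) has_derivative (\<lambda>s. (s *\<^sub>R d) \<bullet> grad h (p t))) (at t)"
      by (rule has_derivative_compose[rotated])
    then have hp: "((\<lambda>t. h (p t)) has_real_derivative (d \<bullet> grad h (p t))) (at t)"
      unfolding has_field_derivative_def by (rule has_derivative_eq_rhs) auto
    have "(\<phi> has_real_derivative (d \<bullet> grad h (p t) - grad h a \<bullet> d - L * t * (norm d)\<^sup>2)) (at t)"
      unfolding \<phi>_def by (rule derivative_eq_intros hp refl | simp)+
    moreover have "d \<bullet> grad h (p t) - grad h a \<bullet> d - L * t * (norm d)\<^sup>2 \<le> 0"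
    proof -
      have "d \<bullet> grad h (p t) - grad h a \<bullet> d = d \<bullet> (grad h (p t) - grad h a)"
        by (simp add: inner_diff_right inner_commute)
      also have "\<dots> \<le> norm d * norm (grad h (p t) - grad h a)" by (rule norm_cauchy_schwarz)
      also have "\<dots> \<le> norm d * (L * norm (p t - a))"
        using lipschitz_onD[OF lip pS[OF t] ab(1)] by (intro mult_left_mono) (auto simp: dist_norm)
      also have "\<dots> = L * t * (norm d)\<^sup>2" using t by (simp add: p_def power2_eq_square)
      finally show ?thesis by simp
    qed
    ultimately show "\<exists>y. DERIV \<phi> t :> y \<and> y \<le> 0" by blast
  qed simp
  then show ?thesis by (simp add: \<phi>_def p_def d_def inner_commute)
qed

lemma norm_add_scaled_sq:
  fixes a b :: "'a::real_inner"
  shows "(norm (a + t *\<^sub>R b))\<^sup>2 = (norm a)\<^sup>2 + 2 * t * (a \<bullet> b) + t\<^sup>2 * (norm b)\<^sup>2"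
  unfolding power2_norm_eq_inner
  by (simp add: inner_simps inner_commute algebra_simps power2_eq_square)

text \<open>A minimiser \<open>p\<close> of \<open>g\<close> plus a quadratic centred at \<open>q\<close> is compared with the points \<open>w\<close> of the
  segment from \<open>p\<close> to \<open>z\<close>. Divided by the step length \<open>t\<close>, the comparison is \<open>0 \<le> A + t B\<close>, and
  \<open>t \<rightarrow> 0\<close> leaves the claim \<open>0 \<le> A\<close>: the vector \<open>(q - p) / \<delta>\<close> is a subgradient at \<open>p\<close> of \<open>g\<close>
  restricted to \<open>S\<close>.\<close>
lemma prox_first_order:
  fixes g :: "'a::real_inner \<Rightarrow> ereal"
  assumes g: "proper_fun g" "convex_fun g" and S: "convex S" and "S \<inter> edom g \<noteq> {}" and "0 < \<delta>"
    and p: "is_arg_min (\<lambda>z. g z + ereal (1 / (2 * \<delta>) * (norm (z - q))\<^sup>2)) (\<lambda>z. z \<in> S) p"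
  shows "p \<in> S \<inter> edom g"
    and "\<And>z. z \<in> S \<Longrightarrow> g p + ereal ((1 / \<delta>) * ((q - p) \<bullet> (z - p))) \<le> g z"
proof -
  define \<phi> where "\<phi> w = real_of_ereal (g w)" for w
  note g\<phi> = proper_fun_finite[OF g(1), folded \<phi>_def]
  have conv: "convex_on (edom g) \<phi>" using convex_fun_real[OF g] by (simp add: \<phi>_def[abs_def])
  have min: "g p + ereal (1 / (2 * \<delta>) * (norm (p - q))\<^sup>2) \<le> g z + ereal (1 / (2 * \<delta>) * (norm (z - q))\<^sup>2)"
    if "z \<in> S" for z using p that by (auto simp: is_arg_min_def not_less)
  have "p \<in> S" using p by (simp add: is_arg_min_def)
  obtain z0 where z0: "z0 \<in> S" "z0 \<in> edom g" using assms(4) by blast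
  have "g p < \<infinity>"
    using min[OF z0(1)] g\<phi>[OF z0(2)] by (cases "g p") auto
  then show pd: "p \<in> S \<inter> edom g" using \<open>p \<in> S\<close> by (simp add: edom_def)
  fix z assume z: "z \<in> S"
  show "g p + ereal ((1 / \<delta>) * ((q - p) \<bullet> (z - p))) \<le> g z"
  proof (cases "z \<in> edom g")
    case False then show ?thesis by (simp add: edom_def)
  next
    case True
    define A where "A = \<phi> z - \<phi> p - (1 / \<delta>) * ((q - p) \<bullet> (z - p))"
    define B where "B = 1 / (2 * \<delta>) * (norm (z - p))\<^sup>2"
    have step: "0 \<le> A + t * B" if t: "0 < t" "t < 1" for t
    proof -
      define w where "w = (1 - t) *\<^sub>R p + t *\<^sub>R z"
      have w: "w \<in> S" "w \<in> edom g"
        using S conv t pd z True unfolding w_def convex_on_def convex_alt by auto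
      have "\<phi> p + 1 / (2 * \<delta>) * (norm (p - q))\<^sup>2 \<le> \<phi> w + 1 / (2 * \<delta>) * (norm (w - q))\<^sup>2"
        using min[OF w(1)] g\<phi>[OF w(2)] g\<phi>[of p] pd by simp
      moreover have "\<phi> w \<le> (1 - t) * \<phi> p + t * \<phi> z"
        unfolding w_def using convex_onD[OF conv] t pd True by simp
      moreover have "(norm (w - q))\<^sup>2 = (norm (p - q))\<^sup>2 - 2 * t * ((q - p) \<bullet> (z - p)) + t\<^sup>2 * (norm (z - p))\<^sup>2"
      proof -
        have "w - q = (p - q) + t *\<^sub>R (z - p)" by (simp add: w_def algebra_simps)
        then have "(norm (w - q))\<^sup>2 = (norm (p - q))\<^sup>2 + 2 * t * ((p - q) \<bullet> (z - p)) + t\<^sup>2 * (norm (z - p))\<^sup>2"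
          by (simp only: norm_add_scaled_sq)
        moreover have "(p - q) \<bullet> (z - p) = - ((q - p) \<bullet> (z - p))"
          by (metis inner_minus_left minus_diff_eq)
        ultimately show ?thesis by simp
      qed
      ultimately have "0 \<le> t * (\<phi> z - \<phi> p) + 1 / (2 * \<delta>) * (- 2 * t * ((q - p) \<bullet> (z - p)) + t\<^sup>2 * (norm (z - p))\<^sup>2)"
        by (simp add: algebra_simps)
      also have "\<dots> = t * (A + t * B)"
        using \<open>0 < \<delta>\<close> by (simp add: A_def B_def field_simps power2_eq_square)
      finally show ?thesis using t by (simp add: zero_le_mult_iff)
    qed
    have "((\<lambda>t. A + t * B) \<longlongrightarrow> A + 0 * B) (at_right 0)" by (intro tendsto_intros)
    moreover have "\<forall>\<^sub>F t in at_right (0::real). 0 \<le> A + t * B"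
      using eventually_at_right_real[of 0 1] step by (auto elim!: eventually_mono)
    ultimately have "0 \<le> A + 0 * B"
      by (intro tendsto_lowerbound) auto
    then show ?thesis using g\<phi>[OF True] g\<phi>[of p] pd by (simp add: A_def)
  qed
qed

section \<open>Runs of the algorithm\<close>

text \<open>One run of the algorithm, in spaces of any finite dimension. The constraint qualification is
  left to the lemma on stationarity, where a subgradient has to be split.\<close>

locale fpsa_run =
  fixes S U :: "'a::euclidean_space set"
    and g :: "'a \<Rightarrow> ereal" and h :: "'a \<Rightarrow> real"
    and f :: "'b::euclidean_space \<Rightarrow> ereal" and K :: "'a \<Rightarrow> 'b"
    and L \<delta> \<sigma> :: real
    and x u :: "nat \<Rightarrow> 'a" and y :: "nat \<Rightarrow> 'b" and \<theta> :: "nat \<Rightarrow> real"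
  assumes K: "linear K"
    and S: "S \<noteq> {}" "convex S" "compact S"
    and g: "proper_fun g" "convex_fun g" "lsc_fun g"
    and h: "open U" "S \<subseteq> U" "h differentiable_on U" "lipschitz_on L U (grad h)"
    and f: "proper_fun f" "convex_fun f"
    and fK: "K ` S \<subseteq> interior (edom f)" "\<forall>z\<in>S. f (K z) > 0"
    and num: "S \<inter> edom g \<noteq> {}" "(INF z\<in>S. g z + ereal (h z)) \<ge> 0"
    and \<sigma>: "0 < \<sigma>" "\<sigma> < 2"
    and \<delta>: "0 < \<delta>" "ereal \<delta> < 1 / ereal L"
    and alg: "fpsa S g h f K \<delta> \<sigma> x y u \<theta>"
begin

definition g_real :: "'a \<Rightarrow> real" where "g_real z = real_of_ereal (g z)"
definition denom :: "'a \<Rightarrow> real" where "denom z = real_of_ereal (f (K z))"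

text \<open>The update of \<open>x\<close> is a proximal step on \<open>g\<close> over \<open>S\<close>, centred at this point.\<close>

definition centre :: "nat \<Rightarrow> 'a" where
  "centre k = u k - \<delta> *\<^sub>R grad h (x k) + (\<theta> k * \<delta>) *\<^sub>R adjoint K (y (Suc k))"

lemma g_eq: "z \<in> edom g \<Longrightarrow> g z = ereal (g_real z)"
  unfolding g_real_def by (rule proper_fun_finite[OF g(1)])

lemma f_eq: "z \<in> S \<Longrightarrow> f (K z) = ereal (denom z)"
  unfolding denom_def using fK(1) interior_subset by (intro proper_fun_finite[OF f(1)]) blast

lemma denom_pos: "z \<in> S \<Longrightarrow> 0 < denom z"
  using fK(2) f_eq by force

lemma num_nonneg:
  assumes "z \<in> S" "z \<in> edom g" shows "0 \<le> g_real z + h z"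
proof -
  have "0 \<le> g z + ereal (h z)"
    using num(2) INF_lower[OF assms(1), of "\<lambda>z. g z + ereal (h z)"] by (rule order_trans)
  then show ?thesis using g_eq[OF assms(2)] by simp
qed

lemma modulus_pos: "0 < 1 / (2 * \<delta>) - L / 2"
proof -
  have "0 \<le> L" using h(4) by (rule lipschitz_on_nonneg)
  have "\<delta> * L < 1"
  proof (cases "L = 0")
    case False
    with \<open>0 \<le> L\<close> have "0 < L" by simp
    then have "ereal \<delta> < ereal (1 / L)" using \<delta>(2) by (simp add: one_ereal_def)
    then show ?thesis using \<open>0 < L\<close> by (simp add: pos_less_divide_eq)
  qed simp
  then show ?thesis using \<delta>(1) by (simp add: field_simps)
qed

lemma h_differentiable: "z \<in> S \<Longrightarrow> h differentiable (at z)"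
  using h by (meson differentiable_on_eq_differentiable_at subsetD)

lemma continuous_h: "continuous_on S h"
  using h_differentiable differentiable_imp_continuous_within
  by (intro continuous_at_imp_continuous_on) blast

lemma continuous_grad: "continuous_on S (grad h)"
  using lipschitz_on_continuous_on[OF h(4)] h(2) continuous_on_subset by blast

lemma continuous_denom: "continuous_on S denom"
proof -
  let ?\<phi> = "\<lambda>w. real_of_ereal (f w)"
  have "continuous_on (interior (edom f)) ?\<phi>" using f by (rule convex_fun_continuous_interior)
  then have "continuous_on S (\<lambda>z. ?\<phi> (K z))"
    using linear_continuous_on[OF linear_conv_bounded_linear[THEN iffD1, OF K]] fK(1)
    by (rule continuous_on_compose2)
  then show ?thesis by (simp add: denom_def[abs_def])
qed

lemma denom_bounds: obtains m M where "0 < m" "\<And>z. z \<in> S \<Longrightarrow> m \<le> denom z" "\<And>z. z \<in> S \<Longrightarrow> denom z \<le> M"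
proof -
  obtain z1 where "z1 \<in> S" "\<forall>z\<in>S. denom z1 \<le> denom z"
    using continuous_attains_inf[OF S(3,1) continuous_denom] by blast
  moreover obtain z2 where "z2 \<in> S" "\<forall>z\<in>S. denom z \<le> denom z2"
    using continuous_attains_sup[OF S(3,1) continuous_denom] by blast
  ultimately show thesis using that[of "denom z1" "denom z2"] denom_pos by blast
qed

lemma y_subdiff: "y (Suc k) \<in> convex_subdiff f (K (x k))"
  using alg limiting_subdiff_convex[OF f] by (auto simp: fpsa_def)

lemma x_argmin:
  "is_arg_min (\<lambda>z. g z + ereal (1 / (2 * \<delta>) * (norm (z - centre k))\<^sup>2)) (\<lambda>z. z \<in> S) (x (Suc k))"
proof -
  have "z - u k + \<delta> *\<^sub>R grad h (x k) - (\<theta> k * \<delta>) *\<^sub>R adjoint K (y (Suc k)) = z - centre k" for z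
    by (simp add: centre_def algebra_simps)
  note eq = this
  have "is_arg_min (\<lambda>z. g z + ereal (1 / (2 * \<delta>) * (norm (z - u k + \<delta> *\<^sub>R grad h (x k)
      - (\<theta> k * \<delta>) *\<^sub>R adjoint K (y (Suc k))))\<^sup>2)) (\<lambda>z. z \<in> S) (x (Suc k))"
    using alg unfolding fpsa_def by blast
  then show ?thesis unfolding eq .
qed

lemma iterate_in: "x k \<in> S" "x k \<in> edom g"
proof -
  have "x k \<in> S \<inter> edom g"
  proof (cases k)
    case 0 then show ?thesis using alg by (simp add: fpsa_def)
  next
    case (Suc j)
    then show ?thesis using prox_first_order(1)[OF g(1,2) S(2) num(1) \<delta>(1) x_argmin[of j]] by simp
  qed
  then show "x k \<in> S" "x k \<in> edom g" by auto
qed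

lemma x_optimality:
  assumes "z \<in> S" "z \<in> edom g"
  shows "g_real (x (Suc k)) + (1 / \<delta>) * ((centre k - x (Suc k)) \<bullet> (z - x (Suc k))) \<le> g_real z"
proof -
  have "ereal (g_real (x (Suc k))) + ereal ((1 / \<delta>) * ((centre k - x (Suc k)) \<bullet> (z - x (Suc k)))) \<le> ereal (g_real z)"
    using prox_first_order(2)[OF g(1,2) S(2) num(1) \<delta>(1) x_argmin[of k] assms(1)]
      g_eq[OF assms(2)] g_eq[OF iterate_in(2)] by simp
  then show ?thesis by simp
qed

lemma merit_eq:
  assumes "z \<in> S" "z \<in> edom g"
  shows "merit S g h f K \<delta> z w = ereal ((g_real z + h z + 1 / (2 * \<delta>) * (norm (z - w))\<^sup>2) / denom z)"
  using assms denom_pos[OF assms(1)]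
  by (simp add: merit_def merit_num_def indicator_fun_def g_eq f_eq)

lemma theta_eq:
  "\<theta> k * denom (x k) = g_real (x k) + h (x k) + 1 / (2 * \<delta>) * (norm (x k - u k))\<^sup>2"
proof -
  have "ereal (\<theta> k) = merit S g h f K \<delta> (x k) (u k)"
    using alg by (cases k) (auto simp: fpsa_def)
  then have "\<theta> k = (g_real (x k) + h (x k) + 1 / (2 * \<delta>) * (norm (x k - u k))\<^sup>2) / denom (x k)"
    using merit_eq[OF iterate_in] by simp
  then show ?thesis using denom_pos[OF iterate_in(1)] by (simp add: less_imp_neq[symmetric])
qed

lemma theta_nonneg: "0 \<le> \<theta> k"
proof -
  have "0 \<le> \<theta> k * denom (x k)"
    unfolding theta_eq using num_nonneg[OF iterate_in, of k] \<delta>(1) by simp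
  then show ?thesis using denom_pos[OF iterate_in(1), of k] by (simp add: zero_le_mult_iff)
qed

text \<open>The proximal inequality is tested with \<open>x k\<close> and combined with the quadratic upper bound for
  \<open>h\<close> and the subgradient bound for \<open>f\<close>. The numerator of \<open>\<theta> k\<close> is \<open>\<theta> k * denom (x k)\<close>, and the bound
  for \<open>f\<close>, multiplied by \<open>\<theta> k \<ge> 0\<close>, turns it into \<open>\<theta> k * denom (x (Suc k))\<close>, which is comparable
  with the new numerator \<open>\<theta> (Suc k) * denom (x (Suc k))\<close>. The term with \<open>e\<close> comes from the update of
  \<open>u\<close>, which multiplies the difference to \<open>x (Suc k)\<close> by \<open>1 - \<sigma>\<close>; here
  \<open>1 - (1 - \<sigma>)\<^sup>2 = \<sigma> (2 - \<sigma>)\<close>.\<close>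
lemma sufficient_decrease:
  defines "c \<equiv> 1 / (2 * \<delta>) - L / 2" and "e \<equiv> \<sigma> * (2 - \<sigma>) / (2 * \<delta>)"
  shows "c * (norm (x (Suc k) - x k))\<^sup>2 + e * (norm (x (Suc k) - u k))\<^sup>2
    \<le> (\<theta> k - \<theta> (Suc k)) * denom (x (Suc k))"
proof -
  define p where "p = x (Suc k)"
  define A where "A = adjoint K (y (Suc k))"
  define D where "D = grad h (x k)"
  have prox: "g_real p + 1 / (2 * \<delta>) * (norm (p - u k))\<^sup>2 + 1 / (2 * \<delta>) * (norm (p - x k))\<^sup>2
      + D \<bullet> (p - x k) - \<theta> k * (A \<bullet> (p - x k)) \<le> g_real (x k) + 1 / (2 * \<delta>) * (norm (x k - u k))\<^sup>2"
  proof -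
    have "g_real p + (1 / \<delta>) * ((centre k - p) \<bullet> (x k - p)) \<le> g_real (x k)"
      unfolding p_def using iterate_in by (rule x_optimality)
    moreover have "(1 / \<delta>) * ((centre k - p) \<bullet> (x k - p)) =
        (1 / \<delta>) * ((u k - p) \<bullet> (x k - p)) + D \<bullet> (p - x k) - \<theta> k * (A \<bullet> (p - x k))"
    proof -
      have "centre k - p = (u k - p) + \<delta> *\<^sub>R (\<theta> k *\<^sub>R A - D)"
        by (simp add: centre_def A_def D_def algebra_simps)
      then have "(1 / \<delta>) * ((centre k - p) \<bullet> (x k - p)) =
          (1 / \<delta>) * ((u k - p) \<bullet> (x k - p)) + (\<theta> k *\<^sub>R A - D) \<bullet> (x k - p)"
        using \<delta>(1) by (simp only: inner_add_left inner_scaleR_left) (simp add: field_simps)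
      then show ?thesis by (simp add: inner_simps algebra_simps)
    qed
    moreover have "(1 / \<delta>) * ((u k - p) \<bullet> (x k - p)) = 1 / (2 * \<delta>) * (norm (p - u k))\<^sup>2
        + 1 / (2 * \<delta>) * (norm (p - x k))\<^sup>2 - 1 / (2 * \<delta>) * (norm (x k - u k))\<^sup>2"
    proof -
      have "(u k - p) \<bullet> (x k - p) =
          ((norm (p - u k))\<^sup>2 + (norm (p - x k))\<^sup>2 - (norm (x k - u k))\<^sup>2) / 2"
        by (simp add: power2_norm_eq_inner inner_simps inner_commute)
      then show ?thesis by (simp add: add_divide_distrib diff_divide_distrib)
    qed
    ultimately show ?thesis by linarith
  qed
  have h_le: "h p \<le> h (x k) + D \<bullet> (p - x k) + L / 2 * (norm (p - x k))\<^sup>2"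
    unfolding p_def D_def
    using descent_lemma[OF h_differentiable S(2) lipschitz_on_subset[OF h(4,2)]] iterate_in(1) by blast
  have "denom (x k) + A \<bullet> (p - x k) \<le> denom p"
  proof -
    have "A \<bullet> (p - x k) = y (Suc k) \<bullet> (K p - K (x k))"
      using adjoint_works[OF K, of "p - x k" "y (Suc k)"] K
      by (simp add: A_def inner_commute linear_diff)
    moreover have "f (K (x k)) + ereal (y (Suc k) \<bullet> (K p - K (x k))) \<le> f (K p)"
      using y_subdiff by (auto simp: convex_subdiff_def)
    ultimately show ?thesis using f_eq[OF iterate_in(1)] by (simp add: p_def)
  qed
  then have f_le: "\<theta> k * denom (x k) + \<theta> k * (A \<bullet> (p - x k)) \<le> \<theta> k * denom p"
    using mult_left_mono[OF _ theta_nonneg] by (metis distrib_left)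
  have u_eq: "1 / (2 * \<delta>) * (norm (p - u (Suc k)))\<^sup>2 =
      1 / (2 * \<delta>) * (norm (p - u k))\<^sup>2 - e * (norm (p - u k))\<^sup>2"
  proof -
    have "p - u (Suc k) = (1 - \<sigma>) *\<^sub>R (p - u k)"
      using alg by (simp add: fpsa_def p_def algebra_simps)
    then have "(norm (p - u (Suc k)))\<^sup>2 = (1 - \<sigma>)\<^sup>2 * (norm (p - u k))\<^sup>2"
      by (simp add: power_mult_distrib)
    then have "1 / (2 * \<delta>) * (norm (p - u (Suc k)))\<^sup>2
        = 1 / (2 * \<delta>) * ((1 - \<sigma>)\<^sup>2 * (norm (p - u k))\<^sup>2)" by simp
    also have "\<dots> = 1 / (2 * \<delta>) * (norm (p - u k))\<^sup>2 - e * (norm (p - u k))\<^sup>2"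
      using \<delta>(1) by (simp add: e_def power2_eq_square field_simps)
    finally show ?thesis .
  qed
  have c_eq: "c * (norm (p - x k))\<^sup>2 = 1 / (2 * \<delta>) * (norm (p - x k))\<^sup>2 - L / 2 * (norm (p - x k))\<^sup>2"
    by (simp add: c_def left_diff_distrib)
  have "c * (norm (p - x k))\<^sup>2 + e * (norm (p - u k))\<^sup>2 \<le> \<theta> k * denom p - \<theta> (Suc k) * denom p"
    using prox h_le f_le theta_eq[of k] theta_eq[of "Suc k"] u_eq c_eq unfolding p_def[symmetric] by linarith
  then show ?thesis by (simp add: p_def left_diff_distrib)
qed

lemma theta_decseq: "decseq \<theta>"
proof (rule decseq_SucI)
  fix k
  have "0 \<le> \<sigma> * (2 - \<sigma>) / (2 * \<delta>)" using \<sigma> \<delta>(1) by simp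
  then have "0 \<le> (\<theta> k - \<theta> (Suc k)) * denom (x (Suc k))"
    using sufficient_decrease[of k] modulus_pos
    by (smt (verit) mult_nonneg_nonneg zero_le_power2)
  then show "\<theta> (Suc k) \<le> \<theta> k" using denom_pos[OF iterate_in(1), of "Suc k"] by (auto simp: zero_le_mult_iff)
qed

lemma theta_convergent: obtains \<theta>b where "\<theta> \<longlonglongrightarrow> \<theta>b" "0 \<le> \<theta>b"
  using decseq_convergent[OF theta_decseq] theta_nonneg by (metis LIMSEQ_le_const)

text \<open>Both squared steps are bounded by multiples of the consecutive differences of the convergent
  sequence \<open>\<theta>\<close>.\<close>
lemma steps_vanish:
  shows "(\<lambda>k. x (Suc k) - x k) \<longlonglongrightarrow> 0" "(\<lambda>k. x (Suc k) - u k) \<longlonglongrightarrow> 0"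
proof -
  obtain \<theta>b where lim: "\<theta> \<longlonglongrightarrow> \<theta>b" by (rule theta_convergent)
  obtain m M where M: "\<And>z. z \<in> S \<Longrightarrow> denom z \<le> M" using denom_bounds by metis
  have null: "(\<lambda>k. v k) \<longlonglongrightarrow> 0"
    if "0 < c" and le: "\<And>k. c * (norm (v k))\<^sup>2 \<le> (\<theta> k - \<theta> (Suc k)) * denom (x (Suc k))"
    for c and v :: "nat \<Rightarrow> 'a"
  proof -
    have "(\<lambda>k. (\<theta> k - \<theta> (Suc k)) * M / c) \<longlonglongrightarrow> (\<theta>b - \<theta>b) * M / c"
      using lim LIMSEQ_Suc[OF lim] \<open>0 < c\<close> by (intro tendsto_intros) auto
    then have bound: "(\<lambda>k. (\<theta> k - \<theta> (Suc k)) * M / c) \<longlonglongrightarrow> 0" by simp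
    have "(norm (v k))\<^sup>2 \<le> (\<theta> k - \<theta> (Suc k)) * M / c" for k
    proof -
      have "(\<theta> k - \<theta> (Suc k)) * denom (x (Suc k)) \<le> (\<theta> k - \<theta> (Suc k)) * M"
        using theta_decseq M[OF iterate_in(1)] by (intro mult_left_mono) (auto simp: decseq_Suc_iff)
      with le[of k] show ?thesis using \<open>0 < c\<close> by (simp add: pos_le_divide_eq mult.commute)
    qed
    then have "\<forall>k. norm ((norm (v k))\<^sup>2) \<le> (\<theta> k - \<theta> (Suc k)) * M / c" by simp
    from Lim_null_comparison[OF always_eventually[OF this] bound]
    have "(\<lambda>k. (norm (v k))\<^sup>2) \<longlonglongrightarrow> 0" .
    then have "(\<lambda>k. sqrt ((norm (v k))\<^sup>2)) \<longlonglongrightarrow> sqrt 0" by (rule tendsto_real_sqrt)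
    then show ?thesis by (simp add: tendsto_norm_zero_iff)
  qed
  have e: "0 < \<sigma> * (2 - \<sigma>) / (2 * \<delta>)" using \<sigma> \<delta>(1) by simp
  show "(\<lambda>k. x (Suc k) - x k) \<longlonglongrightarrow> 0"
  proof (rule null[OF modulus_pos])
    fix k
    have "0 \<le> \<sigma> * (2 - \<sigma>) / (2 * \<delta>) * (norm (x (Suc k) - u k))\<^sup>2" using e by (intro mult_nonneg_nonneg) auto
    with sufficient_decrease[of k]
    show "(1 / (2 * \<delta>) - L / 2) * (norm (x (Suc k) - x k))\<^sup>2 \<le> (\<theta> k - \<theta> (Suc k)) * denom (x (Suc k))"
      by linarith
  qed
  show "(\<lambda>k. x (Suc k) - u k) \<longlonglongrightarrow> 0"
  proof (rule null[OF e])
    fix k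
    have "0 \<le> (1 / (2 * \<delta>) - L / 2) * (norm (x (Suc k) - x k))\<^sup>2" using modulus_pos by (intro mult_nonneg_nonneg) auto
    with sufficient_decrease[of k]
    show "\<sigma> * (2 - \<sigma>) / (2 * \<delta>) * (norm (x (Suc k) - u k))\<^sup>2 \<le> (\<theta> k - \<theta> (Suc k)) * denom (x (Suc k))"
      by linarith
  qed
qed

lemma x_minus_u: "(\<lambda>k. x k - u k) \<longlonglongrightarrow> 0"
  using tendsto_diff[OF steps_vanish(2,1)] by simp

lemma y_bounded: obtains B where "\<And>k. norm (y (Suc k)) \<le> B"
proof -
  have "compact (K ` S)"
    using S(3) linear_continuous_on[OF linear_conv_bounded_linear[THEN iffD1, OF K]]
    by (rule compact_continuous_image[rotated])
  then obtain B where "\<And>z w. z \<in> K ` S \<Longrightarrow> w \<in> convex_subdiff f z \<Longrightarrow> norm w \<le> B"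
    using subgradients_bounded[OF f _ fK(1)] by metis
  then show thesis using that y_subdiff iterate_in(1) by blast
qed

text \<open>The subsequence is thinned out until the subgradients of \<open>f\<close> converge as well; then the
  proximal centres converge to \<open>xb + \<delta> v\<close>. The delicate point is that \<open>g\<close> is only lower
  semicontinuous. The definition of \<open>\<theta>\<close> shows that \<open>g\<close> converges along the shifted subsequence to
  \<open>\<theta>b * denom xb - h xb\<close>. Lower semicontinuity bounds \<open>g xb\<close> by this limit from above, and the
  limit of the optimality condition, tested with \<open>xb\<close> itself, from below. With the value of \<open>g xb\<close>
  known, the same limit tested with all points of \<open>S\<close> says that \<open>v\<close> is a subgradient at \<open>xb\<close> of \<open>g\<close>
  restricted to \<open>S\<close>.\<close>
lemma accumulation:
  assumes lim: "\<theta> \<longlonglongrightarrow> \<theta>b" and r: "strict_mono r" "(x \<circ> r) \<longlonglongrightarrow> xb"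
  shows "xb \<in> S" "xb \<in> edom g" "g_real xb + h xb = \<theta>b * denom xb"
    and "\<exists>yb \<in> convex_subdiff f (K xb). \<forall>z\<in>S.
      g xb + ereal ((\<theta>b *\<^sub>R adjoint K yb - grad h xb) \<bullet> (z - xb)) \<le> g z"
proof -
  obtain B where "\<And>k. norm (y (Suc k)) \<le> B" using y_bounded by blast
  then have "\<forall>n. (y \<circ> Suc \<circ> r) n \<in> cball 0 B" by simp
  then obtain yb r' where r': "strict_mono r'" "((y \<circ> Suc \<circ> r) \<circ> r') \<longlonglongrightarrow> yb"
    using compact_cball[of 0 B] unfolding compact_def by meson
  define s where "s = r \<circ> r'"
  have s: "strict_mono s" unfolding s_def using r(1) r'(1) by (rule strict_mono_o)
  have ys: "(\<lambda>j. y (Suc (s j))) \<longlonglongrightarrow> yb" using r'(2) by (simp add: s_def o_def)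
  have xs: "(\<lambda>j. x (s j)) \<longlonglongrightarrow> xb"
    using LIMSEQ_subseq_LIMSEQ[OF r(2) r'(1)] by (simp add: s_def o_def)
  have ths: "(\<lambda>j. \<theta> (s j)) \<longlonglongrightarrow> \<theta>b" "(\<lambda>j. \<theta> (Suc (s j))) \<longlonglongrightarrow> \<theta>b"
    using LIMSEQ_subseq_LIMSEQ[OF lim s] LIMSEQ_subseq_LIMSEQ[OF LIMSEQ_Suc[OF lim] s] by (simp_all add: o_def)
  have "(\<lambda>j. x (s j) + (x (Suc (s j)) - x (s j))) \<longlonglongrightarrow> xb + 0"
    using LIMSEQ_subseq_LIMSEQ[OF steps_vanish(1) s] by (intro tendsto_add xs) (simp add: o_def)
  then have xs': "(\<lambda>j. x (Suc (s j))) \<longlonglongrightarrow> xb" by simp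
  have "(\<lambda>j. x (s j) - (x (s j) - u (s j))) \<longlonglongrightarrow> xb - 0"
    using LIMSEQ_subseq_LIMSEQ[OF x_minus_u s] by (intro tendsto_diff xs) (simp add: o_def)
  then have us: "(\<lambda>j. u (s j)) \<longlonglongrightarrow> xb" by simp
  have xus': "(\<lambda>j. x (Suc (s j)) - u (Suc (s j))) \<longlonglongrightarrow> 0"
    using LIMSEQ_subseq_LIMSEQ[OF LIMSEQ_Suc[OF x_minus_u] s] by (simp add: o_def)
  show xb: "xb \<in> S"
    by (rule closed_sequentially[OF compact_imp_closed[OF S(3)] iterate_in(1) xs])
  have cont: "(\<lambda>j. F (X j)) \<longlonglongrightarrow> F xb"
    if "continuous_on S F" "X \<longlonglongrightarrow> xb" "\<And>j. X j \<in> S" for F :: "'a \<Rightarrow> 'c::topological_space" and X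
    using continuous_on_tendsto_compose[OF that(1,2) xb] that(3) by simp
  define v where "v = \<theta>b *\<^sub>R adjoint K yb - grad h xb"
  have centre_lim: "(\<lambda>j. centre (s j)) \<longlonglongrightarrow> xb + \<delta> *\<^sub>R v"
  proof -
    have "bounded_linear (adjoint K)" using adjoint_linear[OF K] linear_conv_bounded_linear by blast
    then have "(\<lambda>j. centre (s j)) \<longlonglongrightarrow> xb - \<delta> *\<^sub>R grad h xb + (\<theta>b * \<delta>) *\<^sub>R adjoint K yb"
      unfolding centre_def
      by (intro tendsto_intros us ths ys bounded_linear.tendsto[of "adjoint K"] cont[OF continuous_grad xs] iterate_in(1))
    then show ?thesis by (simp add: v_def algebra_simps)
  qed
  have gx: "g_real (x (Suc (s j))) = \<theta> (Suc (s j)) * denom (x (Suc (s j))) - h (x (Suc (s j)))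
      - 1 / (2 * \<delta>) * (norm (x (Suc (s j)) - u (Suc (s j))))\<^sup>2" for j
    using theta_eq[of "Suc (s j)"] by simp
  have "(\<lambda>j. g_real (x (Suc (s j)))) \<longlonglongrightarrow> \<theta>b * denom xb - h xb - 1 / (2 * \<delta>) * (norm (0::'a))\<^sup>2"
    unfolding gx
    by (intro tendsto_intros ths xus' cont[OF continuous_denom xs'] cont[OF continuous_h xs'] iterate_in(1))
  then have g_lim: "(\<lambda>j. g_real (x (Suc (s j)))) \<longlonglongrightarrow> \<theta>b * denom xb - h xb" by simp
  have lsc: "g xb \<le> ereal (\<theta>b * denom xb - h xb)"
    by (rule lsc_fun_limit_le[OF g(3) xs' _ g_lim]) (simp add: g_eq iterate_in)
  then show xbg: "xb \<in> edom g" unfolding edom_def by (auto intro: le_less_trans)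
  \<comment> \<open>the limit of the optimality condition, with \<open>\<theta>b * denom xb - h xb\<close> in place of \<open>g_real xb\<close>\<close>
  have opt_lim: "(\<theta>b * denom xb - h xb) + (1 / \<delta>) * ((xb + \<delta> *\<^sub>R v - xb) \<bullet> (z - xb)) \<le> g_real z"
    if "z \<in> S" "z \<in> edom g" for z
  proof (rule LIMSEQ_le_const2)
    show "(\<lambda>j. g_real (x (Suc (s j))) + (1 / \<delta>) * ((centre (s j) - x (Suc (s j))) \<bullet> (z - x (Suc (s j)))))
        \<longlonglongrightarrow> (\<theta>b * denom xb - h xb) + (1 / \<delta>) * ((xb + \<delta> *\<^sub>R v - xb) \<bullet> (z - xb))"
      by (intro tendsto_intros g_lim centre_lim xs')
    show "\<exists>N. \<forall>j\<ge>N. g_real (x (Suc (s j))) + (1 / \<delta>) * ((centre (s j) - x (Suc (s j))) \<bullet> (z - x (Suc (s j)))) \<le> g_real z"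
      using x_optimality[OF that] by blast
  qed
  have "\<theta>b * denom xb - h xb \<le> g_real xb" using opt_lim[OF xb xbg] by simp
  with lsc show val: "g_real xb + h xb = \<theta>b * denom xb" unfolding g_eq[OF xbg] by simp
  have "g xb + ereal (v \<bullet> (z - xb)) \<le> g z" if "z \<in> S" for z
  proof (cases "z \<in> edom g")
    case True
    then show ?thesis using opt_lim[OF that True] val \<delta>(1) g_eq[OF True] g_eq[OF xbg] by simp
  qed (simp add: edom_def)
  moreover have "yb \<in> convex_subdiff f (K xb)"
    unfolding convex_subdiff_def
  proof (intro CollectI conjI allI)
    show "\<bar>f (K xb)\<bar> \<noteq> \<infinity>" using f_eq[OF xb] by simp
    fix w
    have Kx: "(\<lambda>j. K (x (s j))) \<longlonglongrightarrow> K xb"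
      using K xs by (intro bounded_linear.tendsto[of K]) (auto simp: linear_conv_bounded_linear)
    show "f (K xb) + ereal (yb \<bullet> (w - K xb)) \<le> f w"
    proof (rule LIMSEQ_le_const2)
      have "(\<lambda>j. ereal (denom (x (s j)) + y (Suc (s j)) \<bullet> (w - K (x (s j)))))
          \<longlonglongrightarrow> ereal (denom xb + yb \<bullet> (w - K xb))"
        by (intro tendsto_intros Kx ys cont[OF continuous_denom xs] iterate_in(1))
      then show "(\<lambda>j. f (K (x (s j))) + ereal (y (Suc (s j)) \<bullet> (w - K (x (s j)))))
          \<longlonglongrightarrow> f (K xb) + ereal (yb \<bullet> (w - K xb))"
        by (simp add: f_eq xb iterate_in(1))
      show "\<exists>N. \<forall>j\<ge>N. f (K (x (s j))) + ereal (y (Suc (s j)) \<bullet> (w - K (x (s j)))) \<le> f w"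
        using y_subdiff unfolding convex_subdiff_def by blast
    qed
  qed
  ultimately show "\<exists>yb \<in> convex_subdiff f (K xb). \<forall>z\<in>S.
      g xb + ereal ((\<theta>b *\<^sub>R adjoint K yb - grad h xb) \<bullet> (z - xb)) \<le> g z"
    unfolding v_def by (intro bexI[of _ yb] ballI)
qed

text \<open>The subgradient \<open>\<theta>b *\<^sub>R adjoint K yb - grad h xb\<close> of \<open>g\<close> restricted to \<open>S\<close> is split by the sum
  rule; multiplied by \<open>f (K xb)\<close>, the splitting is the stationarity condition, since
  \<open>\<theta>b * f (K xb)\<close> is the value of \<open>g + h\<close> at \<open>xb\<close>.\<close>
lemma accumulation_stationary:
  assumes qual: "rel_interior S \<inter> rel_interior (edom g) \<noteq> {} \<or>
            (polyhedron S \<and> S \<inter> rel_interior (edom g) \<noteq> {})"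
    and lim: "\<theta> \<longlonglongrightarrow> \<theta>b" and xb: "xb \<in> accumulation_points x"
  shows "lifted_stationary S g h f K xb"
proof -
  obtain r where r: "strict_mono r" "(x \<circ> r) \<longlonglongrightarrow> xb" using xb by (auto simp: accumulation_points_def)
  note acc = accumulation[OF lim r]
  obtain yb where yb: "yb \<in> convex_subdiff f (K xb)"
    and sub: "\<And>z. z \<in> S \<Longrightarrow> g xb + ereal ((\<theta>b *\<^sub>R adjoint K yb - grad h xb) \<bullet> (z - xb)) \<le> g z"
    using acc(4) by blast
  obtain v w where v: "v \<in> limiting_subdiff g xb" and w: "w \<in> limiting_subdiff (indicator_fun S) xb"
    and sum: "\<theta>b *\<^sub>R adjoint K yb - grad h xb = v + w"
    using subdiff_sum_indicator[OF g(1,2) S(2) qual acc(1,2) sub] by blast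
  have "v + grad h xb + w = \<theta>b *\<^sub>R adjoint K yb" using sum by (simp add: algebra_simps)
  moreover have "real_of_ereal (f (K xb)) = denom xb" by (simp add: denom_def)
  moreover have "real_of_ereal (g xb + ereal (h xb)) = \<theta>b * denom xb"
    using acc(3) by (simp add: g_eq[OF acc(2)])
  ultimately have "real_of_ereal (f (K xb)) *\<^sub>R (v + grad h xb + w)
      - real_of_ereal (g xb + ereal (h xb)) *\<^sub>R adjoint K yb = 0"
    by (simp add: mult.commute)
  then show ?thesis
    unfolding lifted_stationary_def using v w yb limiting_subdiff_convex[OF f]
    by (intro CollectI exI[of _ v] exI[of _ w] exI[of _ yb]) simp
qed

lemma accumulation_value:
  assumes lim: "\<theta> \<longlonglongrightarrow> \<theta>b" and xb: "xb \<in> accumulation_points x"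
  shows "ereal \<theta>b = (g xb + ereal (h xb)) / f (K xb)" "merit S g h f K \<delta> xb xb = ereal \<theta>b"
proof -
  obtain r where r: "strict_mono r" "(x \<circ> r) \<longlonglongrightarrow> xb" using xb by (auto simp: accumulation_points_def)
  note acc = accumulation[OF lim r]
  have "\<theta>b = (g_real xb + h xb) / denom xb" using acc(3) denom_pos[OF acc(1)] by simp
  then show "ereal \<theta>b = (g xb + ereal (h xb)) / f (K xb)" "merit S g h f K \<delta> xb xb = ereal \<theta>b"
    using denom_pos[OF acc(1)] by (simp_all add: g_eq[OF acc(2)] f_eq[OF acc(1)] merit_eq[OF acc(1,2)])
qed

lemma accumulation_triple:
  assumes "(xb, yb, ub) \<in> accumulation_points (\<lambda>k. (x k, y k, u k))"
  shows "xb \<in> accumulation_points x" "ub = xb"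
proof -
  obtain r where r: "strict_mono r" "((\<lambda>k. (x k, y k, u k)) \<circ> r) \<longlonglongrightarrow> (xb, yb, ub)"
    using assms by (auto simp: accumulation_points_def)
  have xr: "(x \<circ> r) \<longlonglongrightarrow> xb" using tendsto_fst[OF r(2)] by (simp add: o_def)
  have ur: "(u \<circ> r) \<longlonglongrightarrow> ub" using tendsto_snd[OF tendsto_snd[OF r(2)]] by (simp add: o_def)
  show "xb \<in> accumulation_points x" using r(1) xr by (auto simp: accumulation_points_def)
  have "(\<lambda>j. x (r j) - u (r j)) \<longlonglongrightarrow> xb - ub" using tendsto_diff[OF xr ur] by (simp add: o_def)
  moreover have "(\<lambda>j. x (r j) - u (r j)) \<longlonglongrightarrow> 0"
    using LIMSEQ_subseq_LIMSEQ[OF x_minus_u r(1)] by (simp add: o_def)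
  ultimately show "ub = xb" using LIMSEQ_unique by fastforce
qed

text \<open>By the Fenchel--Young equality at \<open>K (x k)\<close>, the ratio differs from 1 by
  \<open>K (x (Suc k) - x k) \<bullet> y (Suc k) / f (K (x k))\<close>. The steps vanish, the subgradients are bounded,
  and the denominators stay away from zero.\<close>
lemma conjugate_ratio:
  "(\<lambda>k. (ereal (K (x (Suc k)) \<bullet> y (Suc k)) - conjugate f (y (Suc k))) / f (K (x k))) \<longlonglongrightarrow> 1"
proof -
  obtain B where B: "\<And>k. norm (y (Suc k)) \<le> B" by (rule y_bounded) blast
  obtain m M where m: "0 < m" "\<And>z. z \<in> S \<Longrightarrow> m \<le> denom z" using denom_bounds by metis
  define d where "d k = K (x (Suc k) - x k)" for k
  have ratio: "(ereal (K (x (Suc k)) \<bullet> y (Suc k)) - conjugate f (y (Suc k))) / f (K (x k))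
      = ereal (1 + d k \<bullet> y (Suc k) / denom (x k))" for k
  proof -
    have "0 < denom (x k)" by (rule denom_pos[OF iterate_in(1)])
    then show ?thesis
      unfolding conjugate_at_subgradient[OF y_subdiff] f_eq[OF iterate_in(1)]
      by (simp add: d_def linear_diff[OF K] inner_diff_left add_divide_distrib diff_divide_distrib)
  qed
  have "(\<lambda>k. d k) \<longlonglongrightarrow> K 0"
    unfolding d_def using K steps_vanish(1)
    by (intro bounded_linear.tendsto[of K]) (auto simp: linear_conv_bounded_linear)
  then have "(\<lambda>k. norm (d k) * (B / m)) \<longlonglongrightarrow> norm (0::'b) * (B / m)"
    unfolding linear_0[OF K] by (intro tendsto_intros)
  then have null: "(\<lambda>k. norm (d k) * (B / m)) \<longlonglongrightarrow> 0" by simp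
  have bound: "norm (d k \<bullet> y (Suc k) / denom (x k)) \<le> norm (d k) * (B / m)" for k
  proof -
    have "\<bar>d k \<bullet> y (Suc k)\<bar> \<le> norm (d k) * norm (y (Suc k))" by (rule Cauchy_Schwarz_ineq2)
    also have "\<dots> \<le> norm (d k) * B" by (intro mult_left_mono B) auto
    finally have "\<bar>d k \<bullet> y (Suc k)\<bar> / denom (x k) \<le> norm (d k) * B / m"
      using m m(2)[OF iterate_in(1)[of k]] by (intro frac_le) auto
    then show ?thesis using denom_pos[OF iterate_in(1)] by (simp add: abs_of_pos)
  qed
  from bound have "\<forall>k. norm (d k \<bullet> y (Suc k) / denom (x k)) \<le> norm (d k) * (B / m)" by blast
  from Lim_null_comparison[OF always_eventually[OF this] null]
  have "(\<lambda>k. d k \<bullet> y (Suc k) / denom (x k)) \<longlonglongrightarrow> 0" .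
  then have "(\<lambda>k. 1 + d k \<bullet> y (Suc k) / denom (x k)) \<longlonglongrightarrow> 1 + 0" by (intro tendsto_intros)
  then show ?thesis unfolding ratio one_ereal_def by simp
qed

end

section \<open>Convergence of the algorithm\<close>

theorem theorem5:
  fixes S U :: "(real ^ 'n) set"
    and g :: "real ^ 'n \<Rightarrow> ereal"
    and h :: "real ^ 'n \<Rightarrow> real"
    and f :: "real ^ 'p \<Rightarrow> ereal"
    and K :: "real ^ 'n \<Rightarrow> real ^ 'p"
    and L \<delta> \<sigma> :: real
    and x u :: "nat \<Rightarrow> real ^ 'n"
    and y :: "nat \<Rightarrow> real ^ 'p"
    and \<theta> :: "nat \<Rightarrow> real"
  assumes K: "linear K"
    and Aa: "S \<noteq> {}" "convex S" "compact S"
    and Ab: "proper_fun g" "convex_fun g" "lsc_fun g"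
    and Ac: "open U" "S \<subseteq> U" "h differentiable_on U" "lipschitz_on L U (grad h)"
    and Ad: "proper_fun f" "convex_fun f" "lsc_fun f"
            "K ` S \<subseteq> interior (edom f)" "\<forall>z\<in>S. f (K z) > 0"
    and Ae: "S \<inter> edom g \<noteq> {}" "(INF z\<in>S. g z + ereal (h z)) \<ge> 0"
    and B: "rel_interior S \<inter> rel_interior (edom g) \<noteq> {} \<or>
            (polyhedron S \<and> S \<inter> rel_interior (edom g) \<noteq> {})"
    and \<sigma>: "0 < \<sigma>" "\<sigma> < 2"
    \<comment> \<open>in \<^typ>\<open>ereal\<close>, \<open>1 / 0 = \<infinity>\<close>\<close>
    and \<delta>: "0 < \<delta>" "ereal \<delta> < 1 / ereal L"
    and alg: "fpsa S g h f K \<delta> \<sigma> x y u \<theta>"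
  shows "\<exists>\<theta>bar. \<theta> \<longlonglongrightarrow> \<theta>bar \<and> \<theta>bar \<ge> 0 \<and>
           (\<forall>(xb, yb, ub) \<in> accumulation_points (\<lambda>k. (x k, y k, u k)).
              merit S g h f K \<delta> xb ub = ereal \<theta>bar) \<and>
           (\<forall>xb \<in> accumulation_points x.
              lifted_stationary S g h f K xb \<and>
              ereal \<theta>bar = (g xb + ereal (h xb)) / f (K xb)) \<and>
           (\<lambda>k. (ereal (K (x (Suc k)) \<bullet> y (Suc k)) - conjugate f (y (Suc k))) / f (K (x k)))
             \<longlonglongrightarrow> 1"
proof -
  interpret fpsa_run S U g h f K L \<delta> \<sigma> x u y \<theta>
    by (rule fpsa_run.intro) (fact assms)+
  obtain \<theta>b where lim: "\<theta> \<longlonglongrightarrow> \<theta>b" and nonneg: "0 \<le> \<theta>b" by (rule theta_convergent)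
  have triple: "\<forall>(xb, yb, ub) \<in> accumulation_points (\<lambda>k. (x k, y k, u k)).
      merit S g h f K \<delta> xb ub = ereal \<theta>b"
  proof clarify
    fix xb yb ub assume "(xb, yb, ub) \<in> accumulation_points (\<lambda>k. (x k, y k, u k))"
    from accumulation_triple[OF this] show "merit S g h f K \<delta> xb ub = ereal \<theta>b"
      using accumulation_value(2)[OF lim] by simp
  qed
  have points: "\<forall>xb \<in> accumulation_points x. lifted_stationary S g h f K xb \<and>
      ereal \<theta>b = (g xb + ereal (h xb)) / f (K xb)"
    using accumulation_stationary[OF B lim] accumulation_value(1)[OF lim] by (intro ballI conjI)
  show ?thesis by (intro exI[of _ \<theta>b] conjI lim nonneg triple points conjugate_ratio)
qed

end
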